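(* For every finite group $G$, the unitary cover $\Gamma_{\mathrm u}(G)$ is a central extension of $G$ with the projective lifting property, and it has minimal exponent among all (finite) central extensions of $G$ with the projective lifting property. Moreover, for every normal subgroup $N$ of $G$: (i) $\exp \mathrm{M}(G)$ divides $\exp\Gamma_{\mathrm u}(N)\cdot\exp \mathrm{M}(G/N)$; (ii) $\exp\Gamma_{\mathrm u}(G)$ divides $\exp\Gamma_{\mathrm u}(N)\cdot\exp\Gamma_{\mathrm u}(G/N)$; (iii) $\Gamma_{\mathrm u}(G/N)$ is a homomorphic image of $\Gamma_{\mathrm u}(G)$. If in addition $G=N\rtimes H$ for a subgroup $H$ of $G$, then: (iv) $\exp \mathrm{M}(G)$ divides $\mathrm{lcm}\{\exp\Gamma_{\mathrm u}(N),\ \exp \mathrm{M}(H)\}$; (v) $\exp\Gamma_{\mathrm u}(G)$ divides $\mathrm{lcm}\{\exp\Gamma_{\mathrm u}(N)\cdot\exp H,\ \exp\Gamma_{\mathrm u}(H)\}$.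
   Context: All groups are finite; $\exp$ is the exponent, $o(g)$ the order of $g$. $Z^2(G)$ is the group, under pointwise multiplication, of normalized 2-cocycles $\alpha:G\times G\to\mathbb{C}^\times$, i.e. $\alpha(x,y)\alpha(xy,z)=\alpha(x,yz)\alpha(y,z)$ and $\alpha(1,1)=1$. $B^2(G)\le Z^2(G)$ is the subgroup of coboundaries $\delta\zeta(x,y)=\zeta(x)\zeta(y)\zeta(xy)^{-1}$ with $\zeta:G\to\mathbb{C}^\times$. $\mathrm{M}(G)=Z^2(G)/B^2(G)=H^2(G,\mathbb{C}^\times)$ is the Schur multiplier. For a finite abelian group $A$, $\check A=\mathrm{Hom}(A,\mathbb{C}^\times)$. For a finite subgroup $H\le Z^2(G)$, the central extension $1\to\check H\to\check H\propto G\to G\to 1$ is defined on the set $G\times\check H$ with multiplication $(g,\chi)(h,\psi)=(gh,\omega(g,h)\chi\psi)$, where $\omega(g,h)\in\check H$ is $\omega(g,h)(\alpha)=\alpha(g,h)$ for $\alpha\in H$. A cocycle $\alpha\in Z^2(G)$ is unitary if $\prod_{j=0}^{o(g)-1}\alpha(g,g^j)=1$ for every $g\in G$. The unitary cocycles form a finite subgroup $Z_{\mathrm u}(G)\le Z^2(G)$, and the unitary cover of $G$ is $\Gamma_{\mathrm u}(G)=\check{Z_{\mathrm u}(G)}\propto G$. A central extension of $G$ is an exact sequence $1\to A\to\Gamma\xrightarrow{\pi}G\to1$ with $A=\ker\pi\le Z(\Gamma)$. Given a section $\phi:G\to\Gamma$ of $\pi$, define $\omega_\Gamma:G\times G\to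 A$ by $\phi(g)\phi(h)=\omega_\Gamma(g,h)\phi(gh)$. The standard map is the homomorphism $\eta:\check A\to \mathrm{M}(G)$, $\eta(\lambda)=[\lambda\circ\omega_\Gamma]$ (independent of $\phi$). The extension has the projective lifting property if $\eta$ is surjective. *)

theory Defs
  imports "HOL-Algebra.Algebra" Complex_Main
begin

text \<open>
  The exponent of a group. For a finite group this is the least positive \<open>n\<close> with \<open>g\<^sup>n = 1\<close>
  for all \<open>g\<close>; the lemma below characterises it. The value is 0 if no such \<open>n\<close> exists.
\<close>

definition exponent :: "('a, 'b) monoid_scheme \<Rightarrow> nat" where
  "exponent G = Lcm (group.ord G ` carrier G)"

lemma (in group) exponent_dvd_iff:
  "exponent G dvd n \<longleftrightarrow> (\<forall>g\<in>carrier G. g [^] n = \<one>)"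
  by (auto simp: exponent_def Lcm_dvd_iff pow_eq_id)

definition center :: "('a, 'b) monoid_scheme \<Rightarrow> 'a set" where
  "center G = {z \<in> carrier G. \<forall>g\<in>carrier G. z \<otimes>\<^bsub>G\<^esub> g = g \<otimes>\<^bsub>G\<^esub> z}"

definition is_semidirect_product :: "('a, 'b) monoid_scheme \<Rightarrow> 'a set \<Rightarrow> 'a set \<Rightarrow> bool" where
  "is_semidirect_product G N H \<longleftrightarrow>
     N \<lhd> G \<and> subgroup H G \<and> N <#>\<^bsub>G\<^esub> H = carrier G \<and> N \<inter> H = {\<one>\<^bsub>G\<^esub>}"

definition complex_mult_group :: "complex monoid" where
  "complex_mult_group = \<lparr>carrier = - {0}, monoid.mult = (*), one = 1\<rparr>"

text \<open>
  All complex-valued functions below (cocycles and characters) are extensional, i.e.\ undefined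
  outside their domain, so that equality of elements is equality of functions on the domain.
  They are multiplied pointwise, as in \<^const>\<open>product_group\<close>.
\<close>

definition character_group :: "('a, 'b) monoid_scheme \<Rightarrow> ('a \<Rightarrow> complex) monoid" where
  "character_group A =
     (product_group (carrier A) (\<lambda>_. complex_mult_group))
       \<lparr>carrier := hom A complex_mult_group \<inter> extensional (carrier A)\<rparr>"


subsection \<open>Cocycles and the Schur multiplier\<close>

definition cocycle_group :: "('a, 'b) monoid_scheme \<Rightarrow> ('a \<times> 'a \<Rightarrow> complex) monoid" where
  "cocycle_group G =
     (product_group (carrier G \<times> carrier G) (\<lambda>_. complex_mult_group))
       \<lparr>carrier := {\<alpha> \<in> carrier G \<times> carrier G \<rightarrow>\<^sub>E - {0}.
          (\<forall>x\<in>carrier G. \<forall>y\<in>carrier G. \<forall>z\<in>carrier G.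
             \<alpha> (x, y) * \<alpha> (x \<otimes>\<^bsub>G\<^esub> y, z) = \<alpha> (x, y \<otimes>\<^bsub>G\<^esub> z) * \<alpha> (y, z)) \<and>
          \<alpha> (\<one>\<^bsub>G\<^esub>, \<one>\<^bsub>G\<^esub>) = 1}\<rparr>"

definition coboundary :: "('a, 'b) monoid_scheme \<Rightarrow> ('a \<Rightarrow> complex) \<Rightarrow> 'a \<times> 'a \<Rightarrow> complex" where
  "coboundary G \<zeta> =
     (\<lambda>(x, y)\<in>carrier G \<times> carrier G. \<zeta> x * \<zeta> y * inverse (\<zeta> (x \<otimes>\<^bsub>G\<^esub> y)))"

text \<open>
  The value of \<open>\<delta>\<zeta>\<close> at \<open>(1, 1)\<close> is \<open>\<zeta> 1\<close>, so that intersecting with the normalized cocycles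
  amounts to requiring \<open>\<zeta> 1 = 1\<close>.
\<close>

definition coboundaries :: "('a, 'b) monoid_scheme \<Rightarrow> ('a \<times> 'a \<Rightarrow> complex) set" where
  "coboundaries G = coboundary G ` (carrier G \<rightarrow> - {0}) \<inter> carrier (cocycle_group G)"

lemma cocycle_groupD:
  assumes "\<alpha> \<in> carrier (cocycle_group G)"
  shows "\<alpha> \<in> extensional (carrier G \<times> carrier G)"
    and "\<lbrakk>x \<in> carrier G; y \<in> carrier G\<rbrakk> \<Longrightarrow> \<alpha> (x, y) \<noteq> 0"
    and "\<lbrakk>x \<in> carrier G; y \<in> carrier G; z \<in> carrier G\<rbrakk> \<Longrightarrow>
           \<alpha> (x, y) * \<alpha> (x \<otimes>\<^bsub>G\<^esub> y, z) = \<alpha> (x, y \<otimes>\<^bsub>G\<^esub> z) * \<alpha> (y, z)"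
    and "\<alpha> (\<one>\<^bsub>G\<^esub>, \<one>\<^bsub>G\<^esub>) = 1"
  using assms unfolding cocycle_group_def by (simp_all add: PiE_iff)

lemma cocycle_groupI:
  assumes "\<alpha> \<in> extensional (carrier G \<times> carrier G)"
    and "\<And>x y. \<lbrakk>x \<in> carrier G; y \<in> carrier G\<rbrakk> \<Longrightarrow> \<alpha> (x, y) \<noteq> 0"
    and "\<And>x y z. \<lbrakk>x \<in> carrier G; y \<in> carrier G; z \<in> carrier G\<rbrakk> \<Longrightarrow>
           \<alpha> (x, y) * \<alpha> (x \<otimes>\<^bsub>G\<^esub> y, z) = \<alpha> (x, y \<otimes>\<^bsub>G\<^esub> z) * \<alpha> (y, z)"
    and "\<alpha> (\<one>\<^bsub>G\<^esub>, \<one>\<^bsub>G\<^esub>) = 1"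
  shows "\<alpha> \<in> carrier (cocycle_group G)"
  unfolding cocycle_group_def
  using assms(1,2,4) by (simp add: PiE_iff split_paired_all) (intro ballI assms(3))

lemma cocycle_group_mult:
  "\<alpha> \<otimes>\<^bsub>cocycle_group G\<^esub> \<beta> = (\<lambda>p\<in>carrier G \<times> carrier G. \<alpha> p * \<beta> p)"
  by (simp add: cocycle_group_def product_group_def complex_mult_group_def)

lemma cocycle_group_one:
  "\<one>\<^bsub>cocycle_group G\<^esub> = (\<lambda>p\<in>carrier G \<times> carrier G. 1)"
  by (simp add: cocycle_group_def product_group_def complex_mult_group_def)

lemma comm_group_cocycle_group:
  assumes "group G"
  shows "comm_group (cocycle_group G)"
proof -
  interpret G: group G by fact
  let ?Z = "cocycle_group G"
  let ?P = "carrier G \<times> carrier G"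
  show ?thesis
  proof (rule comm_groupI)
    fix \<alpha> \<beta> assume a: "\<alpha> \<in> carrier ?Z" "\<beta> \<in> carrier ?Z"
    show "\<alpha> \<otimes>\<^bsub>?Z\<^esub> \<beta> \<in> carrier ?Z"
    proof (rule cocycle_groupI)
      fix x y z assume x: "x \<in> carrier G" "y \<in> carrier G" "z \<in> carrier G"
      have "\<alpha> (x, y) * \<beta> (x, y) * (\<alpha> (x \<otimes>\<^bsub>G\<^esub> y, z) * \<beta> (x \<otimes>\<^bsub>G\<^esub> y, z)) =
            (\<alpha> (x, y) * \<alpha> (x \<otimes>\<^bsub>G\<^esub> y, z)) * (\<beta> (x, y) * \<beta> (x \<otimes>\<^bsub>G\<^esub> y, z))"
        by (simp only: ac_simps)
      also have "\<dots> = (\<alpha> (x, y \<otimes>\<^bsub>G\<^esub> z) * \<alpha> (y, z)) * (\<beta> (x, y \<otimes>\<^bsub>G\<^esub> z) * \<beta> (y, z))"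
        by (simp only: cocycle_groupD(3)[OF a(1) x] cocycle_groupD(3)[OF a(2) x])
      also have "\<dots> = \<alpha> (x, y \<otimes>\<^bsub>G\<^esub> z) * \<beta> (x, y \<otimes>\<^bsub>G\<^esub> z) * (\<alpha> (y, z) * \<beta> (y, z))"
        by (simp only: ac_simps)
      finally show "(\<alpha> \<otimes>\<^bsub>?Z\<^esub> \<beta>) (x, y) * (\<alpha> \<otimes>\<^bsub>?Z\<^esub> \<beta>) (x \<otimes>\<^bsub>G\<^esub> y, z) =
          (\<alpha> \<otimes>\<^bsub>?Z\<^esub> \<beta>) (x, y \<otimes>\<^bsub>G\<^esub> z) * (\<alpha> \<otimes>\<^bsub>?Z\<^esub> \<beta>) (y, z)"
        using x by (simp add: cocycle_group_mult)
    qed (use a in \<open>simp_all add: cocycle_group_mult cocycle_groupD(2,4)\<close>)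
    show "\<alpha> \<otimes>\<^bsub>?Z\<^esub> \<beta> = \<beta> \<otimes>\<^bsub>?Z\<^esub> \<alpha>"
      by (simp add: cocycle_group_mult mult.commute)
  next
    fix \<alpha> \<beta> \<gamma>
    show "\<alpha> \<otimes>\<^bsub>?Z\<^esub> \<beta> \<otimes>\<^bsub>?Z\<^esub> \<gamma> = \<alpha> \<otimes>\<^bsub>?Z\<^esub> (\<beta> \<otimes>\<^bsub>?Z\<^esub> \<gamma>)"
      by (rule ext) (simp add: cocycle_group_mult restrict_def mult.assoc)
  next
    fix \<alpha> assume a: "\<alpha> \<in> carrier ?Z"
    show "\<one>\<^bsub>?Z\<^esub> \<otimes>\<^bsub>?Z\<^esub> \<alpha> = \<alpha>"
      using extensional_arb[OF cocycle_groupD(1)[OF a]]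
      by (intro ext) (simp add: cocycle_group_mult cocycle_group_one restrict_def)
    show "\<exists>\<beta>\<in>carrier ?Z. \<beta> \<otimes>\<^bsub>?Z\<^esub> \<alpha> = \<one>\<^bsub>?Z\<^esub>"
    proof (rule bexI)
      show "(\<lambda>p\<in>?P. inverse (\<alpha> p)) \<in> carrier ?Z"
      proof (rule cocycle_groupI)
        fix x y z assume x: "x \<in> carrier G" "y \<in> carrier G" "z \<in> carrier G"
        then show "(\<lambda>p\<in>?P. inverse (\<alpha> p)) (x, y) * (\<lambda>p\<in>?P. inverse (\<alpha> p)) (x \<otimes>\<^bsub>G\<^esub> y, z) =
            (\<lambda>p\<in>?P. inverse (\<alpha> p)) (x, y \<otimes>\<^bsub>G\<^esub> z) * (\<lambda>p\<in>?P. inverse (\<alpha> p)) (y, z)"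
          using arg_cong[OF cocycle_groupD(3)[OF a x], of inverse] by simp
      qed (use a in \<open>simp_all add: cocycle_groupD(2,4)\<close>)
      show "(\<lambda>p\<in>?P. inverse (\<alpha> p)) \<otimes>\<^bsub>?Z\<^esub> \<alpha> = \<one>\<^bsub>?Z\<^esub>"
        using cocycle_groupD(2)[OF a]
        by (intro ext) (auto simp: cocycle_group_mult cocycle_group_one restrict_def)
    qed
  next
    show "\<one>\<^bsub>?Z\<^esub> \<in> carrier ?Z"
      by (rule cocycle_groupI) (simp_all add: cocycle_group_one)
  qed
qed

lemma coboundary_in_coboundaries:
  assumes "group G" "\<zeta> \<in> carrier G \<rightarrow> - {0}" "\<zeta> \<one>\<^bsub>G\<^esub> = 1"
  shows "coboundary G \<zeta> \<in> coboundaries G"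
proof -
  interpret G: group G by fact
  have nz: "\<zeta> x \<noteq> 0" if "x \<in> carrier G" for x using assms(2) that by auto
  have "coboundary G \<zeta> \<in> carrier (cocycle_group G)"
    by (rule cocycle_groupI) (simp_all add: coboundary_def nz G.m_assoc assms(3) field_simps)
  then show ?thesis using assms(2) by (auto simp: coboundaries_def)
qed

lemma coboundariesE:
  assumes "group G" "\<alpha> \<in> coboundaries G"
  obtains \<zeta> where "\<zeta> \<in> carrier G \<rightarrow> - {0}" "\<zeta> \<one>\<^bsub>G\<^esub> = 1" "\<alpha> = coboundary G \<zeta>"
proof -
  interpret G: group G by fact
  obtain \<zeta> where z: "\<zeta> \<in> carrier G \<rightarrow> - {0}" "\<alpha> = coboundary G \<zeta>"
    using assms(2) by (auto simp: coboundaries_def)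
  have "\<alpha> (\<one>\<^bsub>G\<^esub>, \<one>\<^bsub>G\<^esub>) = 1"
    using assms(2) by (simp add: coboundaries_def cocycle_groupD(4))
  moreover have "\<zeta> \<one>\<^bsub>G\<^esub> \<noteq> 0" using z(1) by auto
  ultimately have "\<zeta> \<one>\<^bsub>G\<^esub> = 1" using z(2) by (simp add: coboundary_def mult.assoc)
  with z show ?thesis using that by blast
qed

lemma subgroup_coboundaries:
  assumes "group G"
  shows "subgroup (coboundaries G) (cocycle_group G)"
proof -
  interpret G: group G by fact
  interpret Z: comm_group "cocycle_group G" using assms by (rule comm_group_cocycle_group)
  have mult: "coboundary G \<zeta> \<otimes>\<^bsub>cocycle_group G\<^esub> coboundary G \<xi> = coboundary G (\<lambda>x. \<zeta> x * \<xi> x)" for \<zeta> \<xi>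
    by (auto simp: cocycle_group_mult coboundary_def restrict_def fun_eq_iff)
  show ?thesis
  proof (rule Z.subgroupI)
    show "coboundaries G \<subseteq> carrier (cocycle_group G)" by (auto simp: coboundaries_def)
    show "coboundaries G \<noteq> {}"
      using coboundary_in_coboundaries[OF assms, of "\<lambda>_. 1"] by auto
  next
    fix \<alpha> assume a: "\<alpha> \<in> coboundaries G"
    then obtain \<zeta> where z: "\<zeta> \<in> carrier G \<rightarrow> - {0}" "\<zeta> \<one>\<^bsub>G\<^esub> = 1" "\<alpha> = coboundary G \<zeta>"
      using coboundariesE[OF assms] by metis
    let ?b = "coboundary G (\<lambda>x. inverse (\<zeta> x))"
    have b: "?b \<in> coboundaries G"
      by (rule coboundary_in_coboundaries) (use z assms in auto)
    have nz: "\<zeta> x \<noteq> 0" if "x \<in> carrier G" for x using z(1) that by auto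
    have "?b \<otimes>\<^bsub>cocycle_group G\<^esub> \<alpha> = \<one>\<^bsub>cocycle_group G\<^esub>"
      unfolding z(3) mult
      by (auto simp: cocycle_group_one coboundary_def restrict_def fun_eq_iff nz)
    then have "inv\<^bsub>cocycle_group G\<^esub> \<alpha> = ?b"
      using a b by (intro Z.inv_equality) (auto simp: coboundaries_def)
    with b show "inv\<^bsub>cocycle_group G\<^esub> \<alpha> \<in> coboundaries G" by simp
  next
    fix \<alpha> \<beta> assume "\<alpha> \<in> coboundaries G" "\<beta> \<in> coboundaries G"
    then obtain \<zeta> \<xi> where "\<zeta> \<in> carrier G \<rightarrow> - {0}" "\<zeta> \<one>\<^bsub>G\<^esub> = 1" "\<alpha> = coboundary G \<zeta>"
      and "\<xi> \<in> carrier G \<rightarrow> - {0}" "\<xi> \<one>\<^bsub>G\<^esub> = 1" "\<beta> = coboundary G \<xi>"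
      using coboundariesE[OF assms] by metis
    then show "\<alpha> \<otimes>\<^bsub>cocycle_group G\<^esub> \<beta> \<in> coboundaries G"
      using coboundary_in_coboundaries[OF assms, of "\<lambda>x. \<zeta> x * \<xi> x"]
      by (auto simp: mult Pi_def)
  qed
qed

definition schur_multiplier :: "('a, 'b) monoid_scheme \<Rightarrow> ('a \<times> 'a \<Rightarrow> complex) set monoid" where
  "schur_multiplier G = cocycle_group G Mod coboundaries G"


subsection \<open>Central extensions built from groups of cocycles\<close>

definition evaluation_cocycle ::
  "('a \<times> 'a \<Rightarrow> complex) set \<Rightarrow> 'a \<Rightarrow> 'a \<Rightarrow> ('a \<times> 'a \<Rightarrow> complex) \<Rightarrow> complex" where
  "evaluation_cocycle H g h = (\<lambda>\<alpha>\<in>H. \<alpha> (g, h))"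

definition cocycle_extension ::
  "('a, 'b) monoid_scheme \<Rightarrow> ('a \<times> 'a \<Rightarrow> complex) set
     \<Rightarrow> ('a \<times> (('a \<times> 'a \<Rightarrow> complex) \<Rightarrow> complex)) monoid" where
  "cocycle_extension G H =
     (let D = character_group (cocycle_group G\<lparr>carrier := H\<rparr>) in
        \<lparr>carrier = carrier G \<times> carrier D,
         monoid.mult = (\<lambda>(g, \<chi>) (h, \<psi>). (g \<otimes>\<^bsub>G\<^esub> h, evaluation_cocycle H g h \<otimes>\<^bsub>D\<^esub> \<chi> \<otimes>\<^bsub>D\<^esub> \<psi>)),
         one = (\<one>\<^bsub>G\<^esub>, \<one>\<^bsub>D\<^esub>)\<rparr>)"

definition unitary_cocycles :: "('a, 'b) monoid_scheme \<Rightarrow> ('a \<times> 'a \<Rightarrow> complex) set" where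
  "unitary_cocycles G =
     {\<alpha> \<in> carrier (cocycle_group G).
        \<forall>g\<in>carrier G. (\<Prod>j<group.ord G g. \<alpha> (g, g [^]\<^bsub>G\<^esub> j)) = 1}"

definition unitary_cover ::
  "('a, 'b) monoid_scheme \<Rightarrow> ('a \<times> (('a \<times> 'a \<Rightarrow> complex) \<Rightarrow> complex)) monoid" where
  "unitary_cover G = cocycle_extension G (unitary_cocycles G)"


subsection \<open>Central extensions and the projective lifting property\<close>

text \<open>
  Finite central extensions \<open>1 \<rightarrow> A \<rightarrow> \<Gamma> \<rightarrow> G \<rightarrow> 1\<close>. The group \<open>A\<close> is the kernel of \<open>\<pi>\<close>
  and not a separate argument.
\<close>

definition central_extension ::
  "('c, 'd) monoid_scheme \<Rightarrow> ('c \<Rightarrow> 'a) \<Rightarrow> ('a, 'b) monoid_scheme \<Rightarrow> bool" where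
  "central_extension \<Gamma> \<pi> G \<longleftrightarrow>
     group \<Gamma> \<and> finite (carrier \<Gamma>) \<and> group G \<and> \<pi> \<in> epi \<Gamma> G \<and> kernel \<Gamma> G \<pi> \<subseteq> center \<Gamma>"

text \<open>
  Sections are normalized by \<open>\<phi> 1 = 1\<close>; this is needed for the factor set
  to be normalized.
\<close>

definition is_section ::
  "('c, 'd) monoid_scheme \<Rightarrow> ('c \<Rightarrow> 'a) \<Rightarrow> ('a, 'b) monoid_scheme \<Rightarrow> ('a \<Rightarrow> 'c) \<Rightarrow> bool" where
  "is_section \<Gamma> \<pi> G \<phi> \<longleftrightarrow>
     \<phi> \<in> carrier G \<rightarrow> carrier \<Gamma> \<and> (\<forall>g\<in>carrier G. \<pi> (\<phi> g) = g) \<and> \<phi> \<one>\<^bsub>G\<^esub> = \<one>\<^bsub>\<Gamma>\<^esub>"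

definition factor_set ::
  "('c, 'd) monoid_scheme \<Rightarrow> ('a, 'b) monoid_scheme \<Rightarrow> ('a \<Rightarrow> 'c) \<Rightarrow> 'a \<Rightarrow> 'a \<Rightarrow> 'c" where
  "factor_set \<Gamma> G \<phi> g h = \<phi> g \<otimes>\<^bsub>\<Gamma>\<^esub> \<phi> h \<otimes>\<^bsub>\<Gamma>\<^esub> inv\<^bsub>\<Gamma>\<^esub> \<phi> (g \<otimes>\<^bsub>G\<^esub> h)"

definition standard_map ::
  "('c, 'd) monoid_scheme \<Rightarrow> ('a, 'b) monoid_scheme \<Rightarrow> ('a \<Rightarrow> 'c)
     \<Rightarrow> ('c \<Rightarrow> complex) \<Rightarrow> ('a \<times> 'a \<Rightarrow> complex) set" where
  "standard_map \<Gamma> G \<phi> l =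
     coboundaries G #>\<^bsub>cocycle_group G\<^esub>
       (\<lambda>(g, h)\<in>carrier G \<times> carrier G. l (factor_set \<Gamma> G \<phi> g h))"

lemma factor_set_in_kernel:
  assumes "central_extension \<Gamma> \<pi> G" "is_section \<Gamma> \<pi> G \<phi>" "g \<in> carrier G" "h \<in> carrier G"
  shows "factor_set \<Gamma> G \<phi> g h \<in> kernel \<Gamma> G \<pi>"
proof -
  interpret group_hom \<Gamma> G \<pi>
    using assms(1) by (auto simp: central_extension_def group_hom_def group_hom_axioms_def epi_def)
  have "\<phi> x \<in> carrier \<Gamma>" "\<pi> (\<phi> x) = x" if "x \<in> carrier G" for x
    using assms(2) that by (auto simp: is_section_def)
  then show ?thesis using assms(3,4) by (simp add: factor_set_def kernel_def)
qed

lemma factor_set_mult: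
  assumes "central_extension \<Gamma> \<pi> G" "is_section \<Gamma> \<pi> G \<phi>" "g \<in> carrier G" "h \<in> carrier G"
  shows "\<phi> g \<otimes>\<^bsub>\<Gamma>\<^esub> \<phi> h = factor_set \<Gamma> G \<phi> g h \<otimes>\<^bsub>\<Gamma>\<^esub> \<phi> (g \<otimes>\<^bsub>G\<^esub> h)"
proof -
  interpret group_hom \<Gamma> G \<pi>
    using assms(1) by (auto simp: central_extension_def group_hom_def group_hom_axioms_def epi_def)
  have "\<phi> x \<in> carrier \<Gamma>" if "x \<in> carrier G" for x
    using assms(2) that by (auto simp: is_section_def)
  then show ?thesis using assms(3,4) by (simp add: factor_set_def G.m_assoc)
qed

lemma character_group_mult:
  assumes "l \<in> carrier (character_group (\<Gamma>\<lparr>carrier := A\<rparr>))" "a \<in> A" "b \<in> A"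
  shows "l (a \<otimes>\<^bsub>\<Gamma>\<^esub> b) = l a * l b" "l a \<noteq> 0"
  using assms by (auto simp: character_group_def hom_def complex_mult_group_def)

lemma character_group_one:
  assumes "l \<in> carrier (character_group (\<Gamma>\<lparr>carrier := A\<rparr>))" "group \<Gamma>" "\<one>\<^bsub>\<Gamma>\<^esub> \<in> A"
  shows "l \<one>\<^bsub>\<Gamma>\<^esub> = 1"
proof -
  interpret group \<Gamma> by fact
  show ?thesis using character_group_mult[OF assms(1,3,3)] by simp
qed

lemma character_factor_set_in_cocycle_group:
  assumes ext: "central_extension \<Gamma> \<pi> G" and sec: "is_section \<Gamma> \<pi> G \<phi>"
    and l: "l \<in> carrier (character_group (\<Gamma>\<lparr>carrier := kernel \<Gamma> G \<pi>\<rparr>))"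
  shows "(\<lambda>(g, h)\<in>carrier G \<times> carrier G. l (factor_set \<Gamma> G \<phi> g h)) \<in> carrier (cocycle_group G)"
proof -
  interpret \<pi>: group_hom \<Gamma> G \<pi>
    using ext by (auto simp: central_extension_def group_hom_def group_hom_axioms_def epi_def)
  let ?w = "factor_set \<Gamma> G \<phi>"
  let ?A = "kernel \<Gamma> G \<pi>"
  note wA = factor_set_in_kernel[OF ext sec] and wm = factor_set_mult[OF ext sec]
  have A: "?A \<subseteq> carrier \<Gamma>" by (auto simp: kernel_def)
  have cen: "a \<otimes>\<^bsub>\<Gamma>\<^esub> b = b \<otimes>\<^bsub>\<Gamma>\<^esub> a" if "a \<in> ?A" "b \<in> carrier \<Gamma>" for a b
    using ext that by (auto simp: central_extension_def center_def)
  have phi: "\<phi> x \<in> carrier \<Gamma>" if "x \<in> carrier G" for x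
    using sec that by (auto simp: is_section_def)
  have wc: "?w x y \<in> carrier \<Gamma>" if "x \<in> carrier G" "y \<in> carrier G" for x y
    using wA[OF that] A by auto
  have "l (?w x y) * l (?w (x \<otimes>\<^bsub>G\<^esub> y) z) = l (?w x (y \<otimes>\<^bsub>G\<^esub> z)) * l (?w y z)"
    if x: "x \<in> carrier G" and y: "y \<in> carrier G" and z: "z \<in> carrier G" for x y z
  proof -
    let ?t = "\<phi> (x \<otimes>\<^bsub>G\<^esub> (y \<otimes>\<^bsub>G\<^esub> z))"
    have "?w x y \<otimes>\<^bsub>\<Gamma>\<^esub> ?w (x \<otimes>\<^bsub>G\<^esub> y) z \<otimes>\<^bsub>\<Gamma>\<^esub> ?t = ?w x y \<otimes>\<^bsub>\<Gamma>\<^esub> (\<phi> (x \<otimes>\<^bsub>G\<^esub> y) \<otimes>\<^bsub>\<Gamma>\<^esub> \<phi> z)"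
      using x y z wm[of "x \<otimes>\<^bsub>G\<^esub> y" z] by (simp add: wc phi \<pi>.G.m_assoc \<pi>.H.m_assoc)
    also have "\<dots> = \<phi> x \<otimes>\<^bsub>\<Gamma>\<^esub> \<phi> y \<otimes>\<^bsub>\<Gamma>\<^esub> \<phi> z"
      using x y z wm[of x y] by (simp add: wc phi \<pi>.G.m_assoc)
    also have "\<dots> = \<phi> x \<otimes>\<^bsub>\<Gamma>\<^esub> (?w y z \<otimes>\<^bsub>\<Gamma>\<^esub> \<phi> (y \<otimes>\<^bsub>G\<^esub> z))"
      using x y z wm[of y z] by (simp add: phi \<pi>.G.m_assoc)
    also have "\<dots> = ?w y z \<otimes>\<^bsub>\<Gamma>\<^esub> (\<phi> x \<otimes>\<^bsub>\<Gamma>\<^esub> \<phi> (y \<otimes>\<^bsub>G\<^esub> z))"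
      using x y z cen[OF wA[OF y z] phi[OF x]] by (simp add: wc phi flip: \<pi>.G.m_assoc)
    also have "\<dots> = ?w y z \<otimes>\<^bsub>\<Gamma>\<^esub> ?w x (y \<otimes>\<^bsub>G\<^esub> z) \<otimes>\<^bsub>\<Gamma>\<^esub> ?t"
      using x y z wm[of x "y \<otimes>\<^bsub>G\<^esub> z"] by (simp add: wc phi \<pi>.G.m_assoc)
    finally have "?w x y \<otimes>\<^bsub>\<Gamma>\<^esub> ?w (x \<otimes>\<^bsub>G\<^esub> y) z = ?w y z \<otimes>\<^bsub>\<Gamma>\<^esub> ?w x (y \<otimes>\<^bsub>G\<^esub> z)"
      using x y z by (simp add: wc phi)
    then have "l (?w x y \<otimes>\<^bsub>\<Gamma>\<^esub> ?w (x \<otimes>\<^bsub>G\<^esub> y) z) = l (?w y z \<otimes>\<^bsub>\<Gamma>\<^esub> ?w x (y \<otimes>\<^bsub>G\<^esub> z))"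
      by simp
    then show ?thesis using x y z by (simp add: character_group_mult(1)[OF l] wA)
  qed
  moreover have "l (?w x y) \<noteq> 0" if "x \<in> carrier G" "y \<in> carrier G" for x y
    using character_group_mult(2)[OF l wA[OF that]] wA[OF that] by blast
  moreover have "l (?w \<one>\<^bsub>G\<^esub> \<one>\<^bsub>G\<^esub>) = 1"
  proof -
    have "?w \<one>\<^bsub>G\<^esub> \<one>\<^bsub>G\<^esub> = \<one>\<^bsub>\<Gamma>\<^esub>"
      using sec by (simp add: factor_set_def is_section_def)
    moreover have "\<one>\<^bsub>\<Gamma>\<^esub> \<in> ?A" by (simp add: kernel_def)
    ultimately show ?thesis using character_group_one[OF l] by simp
  qed
  ultimately show ?thesis by (intro cocycle_groupI) simp_all
qed

lemma standard_map_independent: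
  assumes ext: "central_extension \<Gamma> \<pi> G"
    and sec: "is_section \<Gamma> \<pi> G \<phi>" "is_section \<Gamma> \<pi> G \<psi>"
    and l: "l \<in> carrier (character_group (\<Gamma>\<lparr>carrier := kernel \<Gamma> G \<pi>\<rparr>))"
  shows "standard_map \<Gamma> G \<phi> l = standard_map \<Gamma> G \<psi> l"
proof -
  interpret \<pi>: group_hom \<Gamma> G \<pi>
    using ext by (auto simp: central_extension_def group_hom_def group_hom_axioms_def epi_def)
  interpret Z: comm_group "cocycle_group G"
    by (rule comm_group_cocycle_group) (rule \<pi>.H.group_axioms)
  let ?A = "kernel \<Gamma> G \<pi>"
  let ?co = "\<lambda>\<phi>. \<lambda>(g, h)\<in>carrier G \<times> carrier G. l (factor_set \<Gamma> G \<phi> g h)"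
  define c where "c = (\<lambda>g. \<phi> g \<otimes>\<^bsub>\<Gamma>\<^esub> inv\<^bsub>\<Gamma>\<^esub> \<psi> g)"
  have A: "?A \<subseteq> carrier \<Gamma>" by (auto simp: kernel_def)
  have cen: "a \<otimes>\<^bsub>\<Gamma>\<^esub> b = b \<otimes>\<^bsub>\<Gamma>\<^esub> a" if "a \<in> ?A" "b \<in> carrier \<Gamma>" for a b
    using ext that by (auto simp: central_extension_def center_def)
  have s: "\<phi> x \<in> carrier \<Gamma>" "\<psi> x \<in> carrier \<Gamma>" "\<pi> (\<phi> x) = x" "\<pi> (\<psi> x) = x"
    if "x \<in> carrier G" for x
    using sec that by (auto simp: is_section_def)
  have cA: "c x \<in> ?A" if "x \<in> carrier G" for x
    using that by (simp add: c_def kernel_def s)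
  then have cc: "c x \<in> carrier \<Gamma>" if "x \<in> carrier G" for x using A that by auto
  have c\<psi>: "\<phi> x = c x \<otimes>\<^bsub>\<Gamma>\<^esub> \<psi> x" if "x \<in> carrier G" for x
    using that by (simp add: c_def s \<pi>.G.m_assoc)
  have wA: "factor_set \<Gamma> G \<phi> g h \<in> ?A" "factor_set \<Gamma> G \<psi> g h \<in> ?A"
    if "g \<in> carrier G" "h \<in> carrier G" for g h
    using factor_set_in_kernel[OF ext _ that] sec by auto
  have key: "l (factor_set \<Gamma> G \<phi> g h) = l (c g) * l (c h) * inverse (l (c (g \<otimes>\<^bsub>G\<^esub> h))) * l (factor_set \<Gamma> G \<psi> g h)"
    if g: "g \<in> carrier G" and h: "h \<in> carrier G" for g h
  proof -
    let ?w = "factor_set \<Gamma> G \<phi> g h" and ?v = "factor_set \<Gamma> G \<psi> g h" and ?k = "g \<otimes>\<^bsub>G\<^esub> h"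
    have k: "?k \<in> carrier G" using g h by simp
    have wv: "?w \<in> carrier \<Gamma>" "?v \<in> carrier \<Gamma>" using wA[OF g h] A by auto
    have "?w \<otimes>\<^bsub>\<Gamma>\<^esub> c ?k \<otimes>\<^bsub>\<Gamma>\<^esub> \<psi> ?k = \<phi> g \<otimes>\<^bsub>\<Gamma>\<^esub> \<phi> h"
      using factor_set_mult[OF ext sec(1) g h] c\<psi>[OF k] wv by (simp add: \<pi>.G.m_assoc cc s k)
    also have "\<dots> = c g \<otimes>\<^bsub>\<Gamma>\<^esub> (\<psi> g \<otimes>\<^bsub>\<Gamma>\<^esub> c h) \<otimes>\<^bsub>\<Gamma>\<^esub> \<psi> h"
      using c\<psi>[OF g] c\<psi>[OF h] g h by (simp add: \<pi>.G.m_assoc cc s)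
    also have "\<dots> = c g \<otimes>\<^bsub>\<Gamma>\<^esub> c h \<otimes>\<^bsub>\<Gamma>\<^esub> (\<psi> g \<otimes>\<^bsub>\<Gamma>\<^esub> \<psi> h)"
      using cen[OF cA[OF h], of "\<psi> g", symmetric] g h by (simp add: \<pi>.G.m_assoc cc s)
    also have "\<dots> = c g \<otimes>\<^bsub>\<Gamma>\<^esub> c h \<otimes>\<^bsub>\<Gamma>\<^esub> ?v \<otimes>\<^bsub>\<Gamma>\<^esub> \<psi> ?k"
      using factor_set_mult[OF ext sec(2) g h] g h k wv by (simp add: \<pi>.G.m_assoc cc s)
    finally have e: "?w \<otimes>\<^bsub>\<Gamma>\<^esub> c ?k = c g \<otimes>\<^bsub>\<Gamma>\<^esub> c h \<otimes>\<^bsub>\<Gamma>\<^esub> ?v"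
      using g h k wv by (simp add: cc s)
    interpret A: subgroup ?A \<Gamma> by (rule \<pi>.subgroup_kernel)
    have "l ?w * l (c ?k) = l (c g) * l (c h) * l ?v"
      using arg_cong[OF e, of l] g h k wA[OF g h]
      by (simp add: character_group_mult(1)[OF l] cA)
    moreover have "l (c ?k) \<noteq> 0"
      using character_group_mult(2)[OF l cA[OF k]] cA[OF k] by blast
    ultimately show ?thesis by (simp add: field_simps)
  qed
  have B: "coboundary G (\<lambda>x. l (c x)) \<in> coboundaries G"
  proof (rule coboundary_in_coboundaries)
    show "(\<lambda>x. l (c x)) \<in> carrier G \<rightarrow> - {0}"
      using character_group_mult(2)[OF l cA] cA by auto
    have "c \<one>\<^bsub>G\<^esub> = \<one>\<^bsub>\<Gamma>\<^esub>" using sec by (simp add: c_def is_section_def)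
    moreover have "\<one>\<^bsub>\<Gamma>\<^esub> \<in> ?A" by (simp add: kernel_def)
    ultimately show "l (c \<one>\<^bsub>G\<^esub>) = 1" using character_group_one[OF l] by simp
  qed (rule \<pi>.H.group_axioms)
  have "?co \<phi> = coboundary G (\<lambda>x. l (c x)) \<otimes>\<^bsub>cocycle_group G\<^esub> ?co \<psi>"
    by (auto simp: cocycle_group_mult coboundary_def key fun_eq_iff restrict_def)
  then have "?co \<phi> \<in> coboundaries G #>\<^bsub>cocycle_group G\<^esub> ?co \<psi>"
    using B by (auto simp: r_coset_def)
  then have "coboundaries G #>\<^bsub>cocycle_group G\<^esub> ?co \<psi> = coboundaries G #>\<^bsub>cocycle_group G\<^esub> ?co \<phi>"
    using character_factor_set_in_cocycle_group[OF ext sec(2) l]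
      subgroup_coboundaries[OF \<pi>.H.group_axioms]
    by (intro Z.repr_independence)
  then show ?thesis by (simp add: standard_map_def)
qed

text \<open>
  The standard map does not depend on the section, see \<open>standard_map_independent\<close>,
  so that it does not matter whether we ask for one section or for all sections.
\<close>

definition projective_lifting_property ::
  "('c, 'd) monoid_scheme \<Rightarrow> ('c \<Rightarrow> 'a) \<Rightarrow> ('a, 'b) monoid_scheme \<Rightarrow> bool" where
  "projective_lifting_property \<Gamma> \<pi> G \<longleftrightarrow>
     (\<exists>\<phi>. is_section \<Gamma> \<pi> G \<phi> \<and>
        standard_map \<Gamma> G \<phi> ` carrier (character_group (\<Gamma>\<lparr>carrier := kernel \<Gamma> G \<pi>\<rparr>))
          = carrier (schur_multiplier G))"

end

theory Submission
  imports Defs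
begin

text \<open>
  Unitarity of \<open>\<alpha>\<close> says that in the twisted group algebra every standard basis vector \<open>u g\<close> has
  the same order as \<open>g\<close>. Every class contains such a cocycle, since complex numbers have roots, and
  \<open>exponent (unitary_cover G)\<close> divides \<open>n\<close> iff \<open>g\<^sup>n = 1\<close> for all \<open>g\<close> and \<open>\<alpha>\<^sup>n = 1\<close> for all
  unitary \<open>\<alpha>\<close>. If \<open>\<alpha> = \<beta> \<delta>\<zeta>\<close> with \<open>\<alpha>\<close> unitary, then taking products over the powers of \<open>g\<close>
  determines a power of \<open>\<zeta> g\<close>; with \<open>\<beta>\<close> coming from a character of the kernel of a central
  extension this gives minimality. For a normal subgroup \<open>N\<close> and \<open>n\<close> a multiple of the exponent of
  its unitary cover, \<open>\<alpha>\<^sup>n\<close> is trivial on \<open>N\<close>; and if \<open>u x * u g = f u g * u y\<close> with \<open>x\<close>,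
  \<open>y\<close> in \<open>N\<close>, then \<open>f\<^sup>n = 1\<close> because \<open>u x\<close> and \<open>u y\<close> both have order dividing \<open>n\<close>.
  Hence \<open>\<alpha>\<^sup>n\<close> is cohomologous to an inflated cocycle of \<open>G/N\<close>, by a \<open>\<zeta>\<close> that is trivial
  on \<open>N\<close>; for a semidirect product the inflated cocycle is the restriction of \<open>\<alpha>\<^sup>n\<close> to
  the complement.
\<close>

section \<open>Powers in twisted group algebras\<close>

lemma (in group) cocycle_one:
  assumes "\<alpha> \<in> carrier (cocycle_group G)" "x \<in> carrier G"
  shows "\<alpha> (\<one>, x) = 1" and "\<alpha> (x, \<one>) = 1"
  using cocycle_groupD(3)[OF assms(1), of \<one> \<one> x] cocycle_groupD(3)[OF assms(1), of x \<one> \<one>]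
    cocycle_groupD(2,4)[OF assms(1)] assms(2) by auto

text \<open>
  If \<open>u g\<close> is the standard basis of the twisted group algebra, so \<open>u g * u h = \<alpha> (g, h) u (g h)\<close>,
  then this is the scalar relating the \<open>n\<close>-th power of \<open>u g\<close> to \<open>u (g ^ n)\<close>.
\<close>

definition cyclic_product ::
  "('a, 'b) monoid_scheme \<Rightarrow> ('a \<times> 'a \<Rightarrow> complex) \<Rightarrow> 'a \<Rightarrow> nat \<Rightarrow> complex" where
  "cyclic_product G \<alpha> g n = (\<Prod>j<n. \<alpha> (g, g [^]\<^bsub>G\<^esub> j))"

lemma cyclic_product_0 [simp]: "cyclic_product G \<alpha> g 0 = 1"
  and cyclic_product_Suc [simp]:
    "cyclic_product G \<alpha> g (Suc n) = cyclic_product G \<alpha> g n * \<alpha> (g, g [^]\<^bsub>G\<^esub> n)"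
  by (simp_all add: cyclic_product_def)

lemma (in group) cyclic_product_one:
  assumes "\<alpha> \<in> carrier (cocycle_group G)"
  shows "cyclic_product G \<alpha> \<one> n = 1"
  using cocycle_groupD(4)[OF assms] by (simp add: cyclic_product_def)

lemma (in group) cyclic_product_nonzero:
  assumes "\<alpha> \<in> carrier (cocycle_group G)" "g \<in> carrier G"
  shows "cyclic_product G \<alpha> g n \<noteq> 0"
  using assms by (simp add: cyclic_product_def cocycle_groupD(2))

text \<open>Both sides are the coefficient of \<open>u (g ^ (m + n))\<close> in
  \<open>u g ^ (m + n)\<close>, computed once directly and once as the product of
  \<open>u g ^ m\<close> and \<open>u g ^ n\<close>.\<close>

lemma (in group) cyclic_product_add:
  assumes a: "\<alpha> \<in> carrier (cocycle_group G)" and g: "g \<in> carrier G"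
  shows "cyclic_product G \<alpha> g (m + n) =
    cyclic_product G \<alpha> g m * cyclic_product G \<alpha> g n * \<alpha> (g [^] m, g [^] n)"
proof (induction m)
  case 0
  then show ?case using g by (simp add: cocycle_one[OF a])
next
  case (Suc m)
  have "\<alpha> (g, g [^] m) * \<alpha> (g [^] Suc m, g [^] n) = \<alpha> (g, g [^] (m + n)) * \<alpha> (g [^] m, g [^] n)"
    using cocycle_groupD(3)[OF a, of g "g [^] m" "g [^] n"] g
    by (simp add: nat_pow_mult flip: nat_pow_Suc2)
  then show ?case by (simp add: Suc.IH)
qed

lemma (in group) cyclic_product_mult:
  assumes a: "\<alpha> \<in> carrier (cocycle_group G)" and g: "g \<in> carrier G"
  shows "cyclic_product G \<alpha> g (m * n) = cyclic_product G \<alpha> g m ^ n * cyclic_product G \<alpha> (g [^] m) n"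
proof (induction n)
  case (Suc n)
  then show ?case using g by (simp add: cyclic_product_add[OF a g] nat_pow_pow)
qed simp

text \<open>The relation \<open>u x * u g = f * u g * u y\<close> moves one \<open>u x\<close> past
  \<open>u g\<close> at the cost of \<open>f\<close>. Doing so \<open>k\<close> times gives
  \<open>u x ^ k * u g = f ^ k * u g * u y ^ k\<close>, and the claim compares coefficients.\<close>

lemma (in group) cyclic_product_conjugate:
  assumes a: "\<alpha> \<in> carrier (cocycle_group G)"
    and x: "x \<in> carrier G" and y: "y \<in> carrier G" and g: "g \<in> carrier G"
    and xg: "x \<otimes> g = g \<otimes> y" and f: "\<alpha> (x, g) = f * \<alpha> (g, y)"
  shows "cyclic_product G \<alpha> x k * \<alpha> (x [^] k, g) = f ^ k * cyclic_product G \<alpha> y k * \<alpha> (g, y [^] k)"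
proof (induction k)
  case 0
  then show ?case using g by (simp add: cocycle_one[OF a])
next
  case (Suc k)
  have pow: "x [^] k \<otimes> g = g \<otimes> y [^] k" for k :: nat
  proof (induction k)
    case (Suc k)
    have "x [^] Suc k \<otimes> g = x [^] k \<otimes> (g \<otimes> y)" using x g y by (simp add: m_assoc xg)
    also have "\<dots> = g \<otimes> y [^] Suc k" using x g y Suc by (simp flip: m_assoc)
    finally show ?case .
  qed (use g in simp)
  note c = cocycle_groupD(3)[OF a]
  \<comment> \<open>The three identities express associativity of
    \<open>u x * u (x ^ k) * u g\<close>, of \<open>u x * u g * u (y ^ k)\<close> and of
    \<open>u g * u y * u (y ^ k)\<close>; together they carry one more \<open>u x\<close> past
    \<open>u g\<close>.\<close>
  have 1: "\<alpha> (x, x [^] k) * \<alpha> (x [^] Suc k, g) = \<alpha> (x, g \<otimes> y [^] k) * \<alpha> (x [^] k, g)"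
    using c[of x "x [^] k" g] x g pow by (simp flip: nat_pow_Suc2)
  have 2: "\<alpha> (x, g) * \<alpha> (g \<otimes> y, y [^] k) = \<alpha> (x, g \<otimes> y [^] k) * \<alpha> (g, y [^] k)"
    using c[of x g "y [^] k"] x g y by (simp add: xg)
  have 3: "\<alpha> (g, y) * \<alpha> (g \<otimes> y, y [^] k) = \<alpha> (g, y [^] Suc k) * \<alpha> (y, y [^] k)"
    using c[of g y "y [^] k"] g y by (simp flip: nat_pow_Suc2)
  have "cyclic_product G \<alpha> x (Suc k) * \<alpha> (x [^] Suc k, g)
      = cyclic_product G \<alpha> x k * \<alpha> (x [^] k, g) * \<alpha> (x, g \<otimes> y [^] k)"
    using 1 by (simp add: mult.assoc mult.commute)
  also have "\<dots> = f ^ k * cyclic_product G \<alpha> y k * (\<alpha> (x, g \<otimes> y [^] k) * \<alpha> (g, y [^] k))"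
    by (simp add: Suc.IH)
  also have "\<dots> = f ^ Suc k * cyclic_product G \<alpha> y k * (\<alpha> (g, y) * \<alpha> (g \<otimes> y, y [^] k))"
    unfolding 2[symmetric] f by simp
  also have "\<dots> = f ^ Suc k * cyclic_product G \<alpha> y (Suc k) * \<alpha> (g, y [^] Suc k)"
    unfolding 3 by simp
  finally show ?case .
qed

text \<open>Any exponent \<open>n\<close> that kills \<open>g\<close> has the form
  \<open>ord g * m\<close>, so its product is the \<open>m\<close>-th power of the one in the
  definition. Unlike the order, the condition \<open>g ^ n = 1\<close> is preserved by
  homomorphisms.\<close>

lemma (in group) unitary_cocycles_iff:
  assumes fin: "finite (carrier G)"
  shows "\<alpha> \<in> unitary_cocycles G \<longleftrightarrow> \<alpha> \<in> carrier (cocycle_group G) \<and>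
    (\<forall>g\<in>carrier G. \<forall>n. g [^] n = \<one> \<longrightarrow> cyclic_product G \<alpha> g n = 1)"
proof
  assume "\<alpha> \<in> unitary_cocycles G"
  then have a: "\<alpha> \<in> carrier (cocycle_group G)"
    and u: "g \<in> carrier G \<Longrightarrow> cyclic_product G \<alpha> g (ord g) = 1" for g
    by (auto simp: unitary_cocycles_def cyclic_product_def)
  have "cyclic_product G \<alpha> g n = 1" if "g \<in> carrier G" "g [^] n = \<one>" for g n
  proof -
    have "ord g dvd n" using that pow_eq_id by simp
    then obtain m where "n = ord g * m" ..
    then show ?thesis
      using that u by (simp add: cyclic_product_mult[OF a] cyclic_product_one[OF a])
  qed
  then show "\<alpha> \<in> carrier (cocycle_group G) \<and>
    (\<forall>g\<in>carrier G. \<forall>n. g [^] n = \<one> \<longrightarrow> cyclic_product G \<alpha> g n = 1)"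
    using a by blast
qed (auto simp: unitary_cocycles_def cyclic_product_def)

section \<open>Cohomologous cocycles\<close>

text \<open>This is \<open>\<alpha> = \<beta> \<delta>\<zeta>\<close> without division. The witness
  stays visible because powers of its values are computed later, and the two functions may be
  arbitrary, so that plain pointwise powers can be inserted.\<close>

definition cohomologous ::
  "('a, 'b) monoid_scheme \<Rightarrow> ('a \<Rightarrow> complex) \<Rightarrow> ('a \<times> 'a \<Rightarrow> complex) \<Rightarrow> ('a \<times> 'a \<Rightarrow> complex) \<Rightarrow> bool" where
  "cohomologous G \<zeta> \<alpha> \<beta> \<longleftrightarrow> \<zeta> \<in> carrier G \<rightarrow> - {0} \<and> \<zeta> \<one>\<^bsub>G\<^esub> = 1 \<and>
     (\<forall>x\<in>carrier G. \<forall>y\<in>carrier G. \<alpha> (x, y) * \<zeta> (x \<otimes>\<^bsub>G\<^esub> y) = \<beta> (x, y) * \<zeta> x * \<zeta> y)"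

lemma cohomologousD:
  assumes "cohomologous G \<zeta> \<alpha> \<beta>"
  shows "x \<in> carrier G \<Longrightarrow> \<zeta> x \<noteq> 0" and "\<zeta> \<one>\<^bsub>G\<^esub> = 1"
    and "\<lbrakk>x \<in> carrier G; y \<in> carrier G\<rbrakk> \<Longrightarrow> \<alpha> (x, y) * \<zeta> (x \<otimes>\<^bsub>G\<^esub> y) = \<beta> (x, y) * \<zeta> x * \<zeta> y"
  using assms by (auto simp: cohomologous_def)

lemma (in group) cohomologous_sym:
  assumes c: "cohomologous G \<zeta> \<alpha> \<beta>"
  shows "cohomologous G (\<lambda>x. inverse (\<zeta> x)) \<beta> \<alpha>"
  using cohomologousD[OF c] by (auto simp: cohomologous_def field_simps)

lemma (in group) cohomologous_trans:
  assumes c: "cohomologous G \<zeta> \<alpha> \<beta>" and d: "cohomologous G \<xi> \<beta> \<gamma>"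
  shows "cohomologous G (\<lambda>x. \<zeta> x * \<xi> x) \<alpha> \<gamma>"
proof -
  have "\<alpha> (x, y) * (\<zeta> (x \<otimes> y) * \<xi> (x \<otimes> y)) = \<gamma> (x, y) * (\<zeta> x * \<xi> x) * (\<zeta> y * \<xi> y)"
    if "x \<in> carrier G" "y \<in> carrier G" for x y
  proof -
    have "\<alpha> (x, y) * (\<zeta> (x \<otimes> y) * \<xi> (x \<otimes> y)) = (\<beta> (x, y) * \<xi> (x \<otimes> y)) * (\<zeta> x * \<zeta> y)"
      using cohomologousD(3)[OF c that] by (simp add: mult_ac)
    then show ?thesis using cohomologousD(3)[OF d that] by (simp add: mult_ac)
  qed
  then show ?thesis
    using cohomologousD(1,2)[OF c] cohomologousD(1,2)[OF d] by (auto simp: cohomologous_def)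
qed

lemma cohomologous_power:
  assumes c: "cohomologous G \<zeta> \<alpha> \<beta>"
  shows "cohomologous G (\<lambda>x. \<zeta> x ^ n) (\<lambda>p. \<alpha> p ^ n) (\<lambda>p. \<beta> p ^ n)"
  using cohomologousD[OF c] by (auto simp: cohomologous_def simp flip: power_mult_distrib)

lemma cohomologous_cong:
  assumes "cohomologous G \<zeta> \<alpha> \<beta>"
    and "\<And>x y. \<lbrakk>x \<in> carrier G; y \<in> carrier G\<rbrakk> \<Longrightarrow> \<alpha> (x, y) = \<alpha>' (x, y)"
    and "\<And>x y. \<lbrakk>x \<in> carrier G; y \<in> carrier G\<rbrakk> \<Longrightarrow> \<beta> (x, y) = \<beta>' (x, y)"
  shows "cohomologous G \<zeta> \<alpha>' \<beta>'"
  using assms by (auto simp: cohomologous_def)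

lemma (in group_hom) cohomologous_inflation:
  assumes "cohomologous H \<zeta> \<alpha> \<beta>"
  shows "cohomologous G (\<zeta> \<circ> h) (\<lambda>(x, y). \<alpha> (h x, h y)) (\<lambda>(x, y). \<beta> (h x, h y))"
  using assms by (auto simp: cohomologous_def)

text \<open>If \<open>u\<close> is the basis for \<open>\<beta>\<close>, then the vectors
  \<open>\<zeta> g * u g\<close> multiply by \<open>\<alpha>\<close>. Both sides are the coefficient
  of \<open>u (g ^ n)\<close> in the \<open>n\<close>-th power of such a vector.\<close>

lemma (in group) cyclic_product_cohomologous:
  assumes c: "cohomologous G \<zeta> \<alpha> \<beta>" and g: "g \<in> carrier G"
  shows "cyclic_product G \<alpha> g n * \<zeta> (g [^] n) = cyclic_product G \<beta> g n * \<zeta> g ^ n"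
proof (induction n)
  case 0
  then show ?case using cohomologousD(2)[OF c] by simp
next
  case (Suc n)
  have "\<alpha> (g, g [^] n) * \<zeta> (g [^] Suc n) = \<beta> (g, g [^] n) * \<zeta> g * \<zeta> (g [^] n)"
    using cohomologousD(3)[OF c g, of "g [^] n"] g by (simp flip: nat_pow_Suc2)
  then have "cyclic_product G \<alpha> g (Suc n) * \<zeta> (g [^] Suc n)
      = (cyclic_product G \<alpha> g n * \<zeta> (g [^] n)) * (\<beta> (g, g [^] n) * \<zeta> g)"
    by (simp add: mult_ac)
  also have "\<dots> = cyclic_product G \<beta> g (Suc n) * \<zeta> g ^ Suc n"
    unfolding Suc.IH by simp
  finally show ?case .
qed

section \<open>Classes in the Schur multiplier and their powers\<close>

lemma cocycle_group_power:
  assumes "group G" "\<alpha> \<in> carrier (cocycle_group G)"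
  shows "\<alpha> [^]\<^bsub>cocycle_group G\<^esub> n = (\<lambda>p\<in>carrier G \<times> carrier G. \<alpha> p ^ n)"
  by (induction n)
    (simp_all add: nat_pow_def cocycle_group_one cocycle_group_mult restrict_def fun_eq_iff mult.commute)

lemma cocycle_power_closed:
  assumes "group G" "\<alpha> \<in> carrier (cocycle_group G)"
  shows "(\<lambda>p\<in>carrier G \<times> carrier G. \<alpha> p ^ n) \<in> carrier (cocycle_group G)"
proof -
  interpret Z: comm_group "cocycle_group G" by (rule comm_group_cocycle_group) fact
  show ?thesis using Z.nat_pow_closed[OF assms(2)] by (simp add: cocycle_group_power assms)
qed

lemma coboundaries_iff_cohomologous:
  assumes "group G" "\<alpha> \<in> carrier (cocycle_group G)"
  shows "\<alpha> \<in> coboundaries G \<longleftrightarrow> (\<exists>\<zeta>. cohomologous G \<zeta> \<alpha> (\<lambda>_. 1))"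
proof
  interpret group G by fact
  assume "\<alpha> \<in> coboundaries G"
  then obtain \<zeta> where "\<zeta> \<in> carrier G \<rightarrow> - {0}" "\<zeta> \<one>\<^bsub>G\<^esub> = 1" "\<alpha> = coboundary G \<zeta>"
    using coboundariesE[OF assms(1)] by metis
  then have "cohomologous G \<zeta> \<alpha> (\<lambda>_. 1)"
    by (auto simp: cohomologous_def coboundary_def Pi_iff)
  then show "\<exists>\<zeta>. cohomologous G \<zeta> \<alpha> (\<lambda>_. 1)" by blast
next
  interpret group G by fact
  assume "\<exists>\<zeta>. cohomologous G \<zeta> \<alpha> (\<lambda>_. 1)"
  then obtain \<zeta> where c: "cohomologous G \<zeta> \<alpha> (\<lambda>_. 1)" ..
  have "\<alpha> = coboundary G \<zeta>"
  proof
    fix p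
    show "\<alpha> p = coboundary G \<zeta> p"
      using extensional_arb[OF cocycle_groupD(1)[OF assms(2)], of p] cohomologousD[OF c]
      by (cases p) (auto simp: coboundary_def restrict_def field_simps)
  qed
  then show "\<alpha> \<in> coboundaries G"
    using coboundary_in_coboundaries[OF assms(1), of \<zeta>] c by (auto simp: cohomologous_def)
qed

lemma cohomologous_rcos:
  assumes "group G" "\<alpha> \<in> carrier (cocycle_group G)" "\<beta> \<in> carrier (cocycle_group G)"
  shows "coboundaries G #>\<^bsub>cocycle_group G\<^esub> \<alpha> = coboundaries G #>\<^bsub>cocycle_group G\<^esub> \<beta>
    \<longleftrightarrow> (\<exists>\<zeta>. cohomologous G \<zeta> \<alpha> \<beta>)"
proof
  interpret group G by fact
  interpret Z: comm_group "cocycle_group G" by (rule comm_group_cocycle_group) fact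
  interpret B: subgroup "coboundaries G" "cocycle_group G" by (rule subgroup_coboundaries) fact
  {
    assume "coboundaries G #>\<^bsub>cocycle_group G\<^esub> \<alpha> = coboundaries G #>\<^bsub>cocycle_group G\<^esub> \<beta>"
    then have "\<alpha> \<in> coboundaries G #>\<^bsub>cocycle_group G\<^esub> \<beta>"
      using assms B.subgroup_axioms Z.rcos_self by metis
    then obtain \<delta> where "\<delta> \<in> coboundaries G" and e: "\<alpha> = \<delta> \<otimes>\<^bsub>cocycle_group G\<^esub> \<beta>"
      by (auto simp: r_coset_def)
    then obtain \<zeta> where "cohomologous G \<zeta> \<delta> (\<lambda>_. 1)"
      using coboundaries_iff_cohomologous[OF assms(1), of \<delta>] B.subset by auto
    then have "cohomologous G \<zeta> \<alpha> \<beta>"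
      by (auto simp: e cohomologous_def cocycle_group_mult mult_ac)
    then show "\<exists>\<zeta>. cohomologous G \<zeta> \<alpha> \<beta>" by blast
  }
  {
    assume "\<exists>\<zeta>. cohomologous G \<zeta> \<alpha> \<beta>"
    then obtain \<zeta> where c: "cohomologous G \<zeta> \<alpha> \<beta>" ..
    have "\<alpha> p = (coboundary G \<zeta> \<otimes>\<^bsub>cocycle_group G\<^esub> \<beta>) p" for p
      using extensional_arb[OF cocycle_groupD(1)[OF assms(2)], of p] cohomologousD[OF c]
      by (cases p) (auto simp: coboundary_def cocycle_group_mult restrict_def field_simps)
    then have "\<alpha> = coboundary G \<zeta> \<otimes>\<^bsub>cocycle_group G\<^esub> \<beta>" ..
    moreover have "coboundary G \<zeta> \<in> coboundaries G"
      using coboundary_in_coboundaries[OF assms(1), of \<zeta>] c by (auto simp: cohomologous_def)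
    ultimately have "\<alpha> \<in> coboundaries G #>\<^bsub>cocycle_group G\<^esub> \<beta>" by (auto simp: r_coset_def)
    then show "coboundaries G #>\<^bsub>cocycle_group G\<^esub> \<alpha> = coboundaries G #>\<^bsub>cocycle_group G\<^esub> \<beta>"
      using Z.repr_independence[OF _ assms(3) B.subgroup_axioms] by simp
  }
qed

lemma carrier_schur_multiplier:
  "carrier (schur_multiplier G)
    = (\<lambda>\<alpha>. coboundaries G #>\<^bsub>cocycle_group G\<^esub> \<alpha>) ` carrier (cocycle_group G)"
  by (auto simp: schur_multiplier_def FactGroup_def RCOSETS_def)

lemma exponent_schur_multiplier_dvd_iff:
  assumes "group G"
  shows "exponent (schur_multiplier G) dvd n \<longleftrightarrow>
    (\<forall>\<alpha>\<in>carrier (cocycle_group G). \<exists>\<zeta>. cohomologous G \<zeta> (\<lambda>p. \<alpha> p ^ n) (\<lambda>_. 1))"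
proof -
  let ?Z = "cocycle_group G" and ?B = "coboundaries G"
  interpret group G by fact
  interpret Z: comm_group ?Z by (rule comm_group_cocycle_group) fact
  interpret B: subgroup ?B ?Z by (rule subgroup_coboundaries) fact
  interpret N: normal ?B ?Z by (rule Z.subgroup_imp_normal) (rule B.subgroup_axioms)
  interpret M: group "schur_multiplier G"
    unfolding schur_multiplier_def by (rule N.factorgroup_is_group)
  have pow: "(?B #>\<^bsub>?Z\<^esub> \<alpha>) [^]\<^bsub>schur_multiplier G\<^esub> n = ?B #>\<^bsub>?Z\<^esub> (\<alpha> [^]\<^bsub>?Z\<^esub> n)"
    if "\<alpha> \<in> carrier ?Z" for \<alpha>
    using N.FactGroup_pow[OF that] by (simp add: schur_multiplier_def)
  have "(?B #>\<^bsub>?Z\<^esub> \<alpha>) [^]\<^bsub>schur_multiplier G\<^esub> n = \<one>\<^bsub>schur_multiplier G\<^esub>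
      \<longleftrightarrow> (\<exists>\<zeta>. cohomologous G \<zeta> (\<lambda>p. \<alpha> p ^ n) (\<lambda>_. 1))" if a: "\<alpha> \<in> carrier ?Z" for \<alpha>
  proof -
    have "(?B #>\<^bsub>?Z\<^esub> \<alpha>) [^]\<^bsub>schur_multiplier G\<^esub> n = \<one>\<^bsub>schur_multiplier G\<^esub>
        \<longleftrightarrow> ?B #>\<^bsub>?Z\<^esub> (\<alpha> [^]\<^bsub>?Z\<^esub> n) = ?B"
      using pow[OF a] by (simp add: schur_multiplier_def FactGroup_def)
    also have "\<dots> \<longleftrightarrow> \<alpha> [^]\<^bsub>?Z\<^esub> n \<in> ?B"
      using a Z.rcos_self[OF _ B.subgroup_axioms, of "\<alpha> [^]\<^bsub>?Z\<^esub> n"] B.rcos_const[OF Z.group_axioms]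
      by auto
    also have "\<dots> \<longleftrightarrow> (\<exists>\<zeta>. cohomologous G \<zeta> (\<lambda>p\<in>carrier G \<times> carrier G. \<alpha> p ^ n) (\<lambda>_. 1))"
      using cocycle_group_power[OF assms a, of n]
        coboundaries_iff_cohomologous[OF assms cocycle_power_closed[OF assms a, of n]] by simp
    also have "\<dots> \<longleftrightarrow> (\<exists>\<zeta>. cohomologous G \<zeta> (\<lambda>p. \<alpha> p ^ n) (\<lambda>_. 1))"
      by (simp add: cohomologous_def)
    finally show ?thesis .
  qed
  then show ?thesis by (auto simp: M.exponent_dvd_iff carrier_schur_multiplier)
qed

section \<open>Unitary cocycles\<close>

lemma ex_complex_root:
  assumes "n > 0"
  shows "\<exists>w :: complex. w ^ n = z"
proof -
  have "rcis (root n (cmod z)) (Arg z / n) ^ n = z"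
    using assms by (simp add: DeMoivre2 rcis_cmod_Arg)
  then show ?thesis ..
qed

lemma (in group) ex_cohomologous_cocycle:
  assumes a: "\<alpha> \<in> carrier (cocycle_group G)"
    and z: "\<And>g. g \<in> carrier G \<Longrightarrow> \<zeta> g \<noteq> 0" and z1: "\<zeta> \<one> = 1"
  shows "\<exists>\<beta>\<in>carrier (cocycle_group G). cohomologous G \<zeta> \<beta> \<alpha>"
proof -
  interpret Z: comm_group "cocycle_group G" by (rule comm_group_cocycle_group) (rule is_group)
  have "coboundary G \<zeta> \<in> coboundaries G"
    by (rule coboundary_in_coboundaries) (use z z1 in \<open>auto simp: is_group\<close>)
  then have "coboundary G \<zeta> \<otimes>\<^bsub>cocycle_group G\<^esub> \<alpha> \<in> carrier (cocycle_group G)"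
    using a by (intro Z.m_closed) (auto simp: coboundaries_def)
  moreover have "cohomologous G \<zeta> (coboundary G \<zeta> \<otimes>\<^bsub>cocycle_group G\<^esub> \<alpha>) \<alpha>"
    using z z1 by (auto simp: cohomologous_def cocycle_group_mult coboundary_def)
  ultimately show ?thesis by blast
qed

text \<open>Rescaling \<open>u g\<close> by \<open>w\<close> multiplies its \<open>ord g\<close>-th
  power by \<open>w ^ ord g\<close>, so a suitable complex root makes that power 1. Each
  \<open>g\<close> can be treated separately.\<close>

lemma (in group) ex_unitary_cohomologous:
  assumes fin: "finite (carrier G)" and a: "\<alpha> \<in> carrier (cocycle_group G)"
  shows "\<exists>\<beta>\<in>unitary_cocycles G. \<exists>\<zeta>. cohomologous G \<zeta> \<beta> \<alpha>"
proof -
  have "\<exists>w. w ^ ord g * cyclic_product G \<alpha> g (ord g) = 1 \<and> (g = \<one> \<longrightarrow> w = 1)"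
    if g: "g \<in> carrier G" for g
  proof (cases "g = \<one>")
    case True
    then show ?thesis by (intro exI[of _ 1]) (simp add: cocycle_groupD(4)[OF a])
  next
    case False
    have "ord g > 0" using ord_ge_1[OF fin g] by simp
    then obtain w where "w ^ ord g = inverse (cyclic_product G \<alpha> g (ord g))"
      using ex_complex_root by blast
    then show ?thesis
      using False cyclic_product_nonzero[OF a g, of "ord g"] by (intro exI[of _ w]) simp
  qed
  then obtain \<zeta> where z: "\<And>g. g \<in> carrier G \<Longrightarrow> \<zeta> g ^ ord g * cyclic_product G \<alpha> g (ord g) = 1"
    and z1: "\<zeta> \<one> = 1"
    by (metis one_closed)
  have nz: "\<zeta> g \<noteq> 0" if "g \<in> carrier G" for g
    using z[OF that] ord_ge_1[OF fin that] by (auto simp: power_0_left)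
  obtain \<beta> where b: "\<beta> \<in> carrier (cocycle_group G)" and c: "cohomologous G \<zeta> \<beta> \<alpha>"
    using ex_cohomologous_cocycle[of \<alpha> \<zeta>, OF a nz z1] by blast
  have "cyclic_product G \<beta> g (ord g) = 1" if "g \<in> carrier G" for g
    using cyclic_product_cohomologous[OF c that, of "ord g"] z[OF that] that
    by (simp add: z1 mult.commute)
  then have "\<beta> \<in> unitary_cocycles G"
    using b by (simp add: unitary_cocycles_def cyclic_product_def)
  with c show ?thesis by blast
qed

section \<open>Finiteness and group structure of the unitary cocycles\<close>

lemma (in group) prod_translate:
  assumes "x \<in> carrier G"
  shows "(\<Prod>h\<in>carrier G. f (x \<otimes> h)) = (\<Prod>h\<in>carrier G. f h)"
proof (rule prod.reindex_bij_betw)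
  show "bij_betw ((\<otimes>) x) (carrier G) (carrier G)"
    by (rule bij_betwI[where g = "(\<otimes>) (inv x)"]) (use assms in \<open>auto simp flip: m_assoc\<close>)
qed

text \<open>Multiplying the cocycle identity over all third arguments shows that
  \<open>\<alpha> ^ order G\<close> is the coboundary of \<open>z\<close>. Since
  \<open>g ^ order G = 1\<close>, unitarity makes the cyclic products of that length equal to 1,
  which forces \<open>z g ^ order G = 1\<close>; hence the square of the order.\<close>

lemma (in group) unitary_cocycle_root_of_unity:
  assumes fin: "finite (carrier G)" and a: "\<alpha> \<in> unitary_cocycles G"
    and x: "x \<in> carrier G" and y: "y \<in> carrier G"
  shows "\<alpha> (x, y) ^ (order G * order G) = 1"
proof -
  \<comment> \<open>up to sign, the determinant of multiplication by \<open>u g\<close> on the twisted group algebra\<close>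
  define z where "z g = (\<Prod>h\<in>carrier G. \<alpha> (g, h))" for g
  have aZ: "\<alpha> \<in> carrier (cocycle_group G)" using a by (simp add: unitary_cocycles_def)
  note c = cocycle_groupD(3)[OF aZ]
  have eq: "\<alpha> (g, k) ^ order G * z (g \<otimes> k) = z g * z k"
    if g: "g \<in> carrier G" and k: "k \<in> carrier G" for g k
  proof -
    have "\<alpha> (g, k) ^ order G * z (g \<otimes> k) = (\<Prod>h\<in>carrier G. \<alpha> (g, k) * \<alpha> (g \<otimes> k, h))"
      by (simp add: z_def order_def prod.distrib)
    also have "\<dots> = (\<Prod>h\<in>carrier G. \<alpha> (g, k \<otimes> h) * \<alpha> (k, h))"
      using c g k by simp
    also have "\<dots> = z g * z k"
      using prod_translate[OF k, of "\<lambda>h. \<alpha> (g, h)"] by (simp add: z_def prod.distrib)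
    finally show ?thesis .
  qed
  have "z g ^ order G = 1" if g: "g \<in> carrier G" for g
  proof -
    have coh: "cohomologous G z (\<lambda>p. \<alpha> p ^ order G) (\<lambda>_. 1)"
      using eq cocycle_groupD(2)[OF aZ] cocycle_one[OF aZ] fin by (auto simp: cohomologous_def z_def)
    have "cyclic_product G \<alpha> g (order G) = 1"
      using a g pow_order_eq_1 unitary_cocycles_iff[OF fin] by blast
    moreover have "cyclic_product G (\<lambda>p. \<alpha> p ^ order G) g (order G)
        = cyclic_product G \<alpha> g (order G) ^ order G"
      by (simp add: cyclic_product_def prod_power_distrib)
    ultimately show ?thesis
      using cyclic_product_cohomologous[OF coh g, of "order G"] g cohomologousD(2)[OF coh]
      by (simp add: pow_order_eq_1 cyclic_product_def)
  qed
  then have "(\<alpha> (x, y) ^ order G * z (x \<otimes> y)) ^ order G = 1"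
    using x y by (simp add: eq power_mult_distrib)
  then show ?thesis using x y \<open>\<And>g. g \<in> carrier G \<Longrightarrow> z g ^ order G = 1\<close>
    by (simp add: power_mult_distrib power_mult)
qed

lemma (in group) finite_unitary_cocycles:
  assumes fin: "finite (carrier G)"
  shows "finite (unitary_cocycles G)"
proof -
  let ?R = "{c :: complex. c ^ (order G * order G) = 1}"
  have "order G > 0" using fin order_gt_0_iff_finite by simp
  then have "finite ?R" by (intro finite_nth_roots) simp
  then have "finite (carrier G \<times> carrier G \<rightarrow>\<^sub>E ?R)" using fin by (intro finite_PiE) auto
  moreover have "unitary_cocycles G \<subseteq> (carrier G \<times> carrier G \<rightarrow>\<^sub>E ?R)"
  proof
    fix \<alpha> assume a: "\<alpha> \<in> unitary_cocycles G"
    then have "\<alpha> \<in> extensional (carrier G \<times> carrier G)"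
      by (simp add: unitary_cocycles_def cocycle_groupD(1))
    with unitary_cocycle_root_of_unity[OF fin a]
    show "\<alpha> \<in> (carrier G \<times> carrier G \<rightarrow>\<^sub>E ?R)" by (auto simp only: PiE_iff)
  qed
  ultimately show ?thesis by (rule finite_subset[rotated])
qed

lemma (in group) subgroup_unitary_cocycles:
  assumes fin: "finite (carrier G)"
  shows "subgroup (unitary_cocycles G) (cocycle_group G)"
proof -
  interpret Z: comm_group "cocycle_group G" by (rule comm_group_cocycle_group) (rule is_group)
  have sub: "unitary_cocycles G \<subseteq> carrier (cocycle_group G)"
    by (auto simp: unitary_cocycles_def)
  show ?thesis
  proof (rule Z.subgroupI)
    have "(\<lambda>p\<in>carrier G \<times> carrier G. 1) \<in> unitary_cocycles G"
      using Z.one_closed by (simp add: unitary_cocycles_def cocycle_group_one)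
    then show "unitary_cocycles G \<noteq> {}" by blast
  next
    fix \<alpha> \<beta> assume a: "\<alpha> \<in> unitary_cocycles G" and b: "\<beta> \<in> unitary_cocycles G"
    have "\<alpha> \<otimes>\<^bsub>cocycle_group G\<^esub> \<beta> \<in> carrier (cocycle_group G)"
      using a b sub by (intro Z.m_closed) auto
    then show "\<alpha> \<otimes>\<^bsub>cocycle_group G\<^esub> \<beta> \<in> unitary_cocycles G"
      using a b by (simp add: unitary_cocycles_def cocycle_group_mult prod.distrib)
  next
    fix \<alpha> assume a: "\<alpha> \<in> unitary_cocycles G"
    define \<beta> where "\<beta> = inv\<^bsub>cocycle_group G\<^esub> \<alpha>"
    have b: "\<beta> \<in> carrier (cocycle_group G)" using a sub by (auto simp: \<beta>_def)
    have inv: "\<beta> \<otimes>\<^bsub>cocycle_group G\<^esub> \<alpha> = \<one>\<^bsub>cocycle_group G\<^esub>" using a sub by (auto simp: \<beta>_def)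
    have 1: "\<beta> (x, y) * \<alpha> (x, y) = 1" if "x \<in> carrier G" "y \<in> carrier G" for x y
      using that fun_cong[OF inv, of "(x, y)"] by (simp add: cocycle_group_mult cocycle_group_one)
    have "(\<Prod>j < ord g. \<beta> (g, g [^] j)) = 1" if "g \<in> carrier G" for g
    proof -
      have "(\<Prod>j < ord g. \<beta> (g, g [^] j)) * (\<Prod>j < ord g. \<alpha> (g, g [^] j)) = 1"
        using that by (simp add: 1 flip: prod.distrib)
      then show ?thesis using a that by (simp add: unitary_cocycles_def)
    qed
    then show "inv\<^bsub>cocycle_group G\<^esub> \<alpha> \<in> unitary_cocycles G"
      using b by (simp add: unitary_cocycles_def flip: \<beta>_def)
  qed (rule sub)
qed

section \<open>Characters and extensions by groups of cocycles\<close>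

lemma character_group_iff:
  "\<chi> \<in> carrier (character_group A) \<longleftrightarrow>
     \<chi> \<in> extensional (carrier A) \<and> (\<forall>a\<in>carrier A. \<chi> a \<noteq> 0) \<and>
     (\<forall>a\<in>carrier A. \<forall>b\<in>carrier A. \<chi> (a \<otimes>\<^bsub>A\<^esub> b) = \<chi> a * \<chi> b)"
  by (auto simp: character_group_def hom_def complex_mult_group_def)

lemma character_group_ops:
  "\<chi> \<otimes>\<^bsub>character_group A\<^esub> \<psi> = (\<lambda>a\<in>carrier A. \<chi> a * \<psi> a)"
  "\<one>\<^bsub>character_group A\<^esub> = (\<lambda>a\<in>carrier A. 1)"
  by (simp_all add: character_group_def product_group_def complex_mult_group_def)

lemma comm_group_character_group:
  assumes "group A"
  shows "comm_group (character_group A)"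
proof -
  interpret A: group A by fact
  show ?thesis
  proof (rule comm_groupI)
    fix \<chi> assume x: "\<chi> \<in> carrier (character_group A)"
    then show "\<one>\<^bsub>character_group A\<^esub> \<otimes>\<^bsub>character_group A\<^esub> \<chi> = \<chi>"
      by (auto simp: character_group_iff character_group_ops fun_eq_iff extensional_def restrict_def)
    show "\<exists>\<psi>\<in>carrier (character_group A).
        \<psi> \<otimes>\<^bsub>character_group A\<^esub> \<chi> = \<one>\<^bsub>character_group A\<^esub>"
    proof (rule bexI)
      show "(\<lambda>a\<in>carrier A. inverse (\<chi> a)) \<in> carrier (character_group A)"
        using x by (simp add: character_group_iff)
      show "(\<lambda>a\<in>carrier A. inverse (\<chi> a)) \<otimes>\<^bsub>character_group A\<^esub> \<chi>
          = \<one>\<^bsub>character_group A\<^esub>"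
        using x by (auto simp: character_group_iff character_group_ops fun_eq_iff restrict_def)
    qed
  next
    fix \<chi> \<psi> assume "\<chi> \<in> carrier (character_group A)" "\<psi> \<in> carrier (character_group A)"
    then show "\<chi> \<otimes>\<^bsub>character_group A\<^esub> \<psi> \<in> carrier (character_group A)"
      by (simp add: character_group_iff character_group_ops mult_ac)
  next
    show "\<one>\<^bsub>character_group A\<^esub> \<in> carrier (character_group A)"
      by (simp add: character_group_iff character_group_ops)
  qed (auto simp: character_group_ops fun_eq_iff restrict_def mult_ac)
qed

lemma character_power_eq_one:
  assumes "group A" "\<chi> \<in> carrier (character_group A)" "a \<in> carrier A" "a [^]\<^bsub>A\<^esub> n = \<one>\<^bsub>A\<^esub>"
  shows "\<chi> a ^ n = 1"
proof -
  interpret A: group A by fact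
  have x: "\<chi> (b \<otimes>\<^bsub>A\<^esub> c) = \<chi> b * \<chi> c" "\<chi> b \<noteq> 0" if "b \<in> carrier A" "c \<in> carrier A" for b c
    using assms(2) that by (auto simp: character_group_iff)
  have one: "\<chi> \<one>\<^bsub>A\<^esub> = 1" using x[of "\<one>\<^bsub>A\<^esub>" "\<one>\<^bsub>A\<^esub>"] by simp
  have "\<chi> (a [^]\<^bsub>A\<^esub> n) = \<chi> a ^ n" for n :: nat
    by (induction n) (use assms(3) x one in auto)
  then show ?thesis using assms(4) one by metis
qed

lemma finite_character_group:
  assumes "group A" and fin: "finite (carrier A)"
  shows "finite (carrier (character_group A))"
proof -
  interpret A: group A by fact
  let ?R = "{c :: complex. c ^ order A = 1}"
  have "order A > 0" using fin A.order_gt_0_iff_finite by simp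
  then have "finite ?R" by (rule finite_nth_roots)
  then have "finite (carrier A \<rightarrow>\<^sub>E ?R)" using fin by (intro finite_PiE) auto
  moreover have "carrier (character_group A) \<subseteq> (carrier A \<rightarrow>\<^sub>E ?R)"
  proof
    fix \<chi> assume x: "\<chi> \<in> carrier (character_group A)"
    then have "\<chi> \<in> extensional (carrier A)" by (simp add: character_group_iff)
    with character_power_eq_one[OF assms(1) x _ A.pow_order_eq_1]
    show "\<chi> \<in> (carrier A \<rightarrow>\<^sub>E ?R)" by (auto simp only: PiE_iff)
  qed
  ultimately show ?thesis by (rule finite_subset[rotated])
qed

lemma carrier_cocycle_extension:
  "carrier (cocycle_extension G H) = carrier G \<times> carrier (character_group (cocycle_group G\<lparr>carrier := H\<rparr>))"
  by (simp add: cocycle_extension_def Let_def)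

lemma mult_cocycle_extension:
  "(g, \<chi>) \<otimes>\<^bsub>cocycle_extension G H\<^esub> (h, \<psi>)
    = (g \<otimes>\<^bsub>G\<^esub> h, \<lambda>\<alpha>\<in>H. \<alpha> (g, h) * \<chi> \<alpha> * \<psi> \<alpha>)"
  by (auto simp: cocycle_extension_def Let_def character_group_ops evaluation_cocycle_def
      restrict_def fun_eq_iff)

lemma one_cocycle_extension:
  "\<one>\<^bsub>cocycle_extension G H\<^esub> = (\<one>\<^bsub>G\<^esub>, \<lambda>\<alpha>\<in>H. 1)"
  by (simp add: cocycle_extension_def Let_def character_group_ops)

section \<open>The extension attached to a subgroup of cocycles\<close>

locale cocycle_subgroup = group G for G (structure) +
  fixes H
  assumes sub: "subgroup H (cocycle_group G)"
begin

sublocale Z: comm_group "cocycle_group G"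
  by (rule comm_group_cocycle_group) (rule is_group)

sublocale H: subgroup H "cocycle_group G"
  by (rule sub)

abbreviation "dual \<equiv> character_group (cocycle_group G\<lparr>carrier := H\<rparr>)"

abbreviation "E \<equiv> cocycle_extension G H"

lemma H_cocycle: "\<alpha> \<in> H \<Longrightarrow> \<alpha> \<in> carrier (cocycle_group G)"
  using H.subset by auto

sublocale D: comm_group dual
  by (rule comm_group_character_group) (rule H.subgroup_is_group[OF Z.is_group])

lemma dual_iff:
  "\<chi> \<in> carrier dual \<longleftrightarrow> \<chi> \<in> extensional H \<and> (\<forall>a\<in>H. \<chi> a \<noteq> 0) \<and>
     (\<forall>a\<in>H. \<forall>b\<in>H. \<chi> (a \<otimes>\<^bsub>cocycle_group G\<^esub> b) = \<chi> a * \<chi> b)"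
  by (simp add: character_group_iff)

lemma one_dual: "(\<lambda>\<alpha>\<in>H. 1) \<in> carrier dual"
  using D.one_closed by (simp add: character_group_ops)

lemma evaluation_in_dual:
  assumes "g \<in> carrier G" "h \<in> carrier G"
  shows "(\<lambda>\<alpha>\<in>H. \<alpha> (g, h)) \<in> carrier dual"
  using assms cocycle_groupD(2)[OF H_cocycle]
  by (auto simp: dual_iff) (simp add: cocycle_group_mult)

lemma extension_closed:
  assumes "g \<in> carrier G" "h \<in> carrier G" "\<chi> \<in> carrier dual" "\<psi> \<in> carrier dual"
  shows "(\<lambda>\<alpha>\<in>H. \<alpha> (g, h) * \<chi> \<alpha> * \<psi> \<alpha>) \<in> carrier dual"
proof -
  have "(\<lambda>\<alpha>\<in>H. \<alpha> (g, h)) \<otimes>\<^bsub>dual\<^esub> \<chi> \<otimes>\<^bsub>dual\<^esub> \<psi> \<in> carrier dual"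
    using assms evaluation_in_dual by simp
  then show ?thesis by (simp add: character_group_ops restrict_def cong: if_cong)
qed

text \<open>For each \<open>\<alpha>\<close> in \<open>H\<close>, associativity in the character
  component is the cocycle identity of \<open>\<alpha>\<close>.\<close>

lemma group_extension: "group E"
proof (rule groupI)
  fix x y assume "x \<in> carrier E" "y \<in> carrier E"
  then show "x \<otimes>\<^bsub>E\<^esub> y \<in> carrier E"
    by (cases x; cases y) (simp add: carrier_cocycle_extension mult_cocycle_extension extension_closed)
next
  show "\<one>\<^bsub>E\<^esub> \<in> carrier E"
    by (simp add: carrier_cocycle_extension one_cocycle_extension one_dual)
next
  fix x y z assume xyz: "x \<in> carrier E" "y \<in> carrier E" "z \<in> carrier E"
  obtain g \<chi> h \<psi> k \<xi> where e: "x = (g, \<chi>)" "y = (h, \<psi>)" "z = (k, \<xi>)"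
    by (cases x; cases y; cases z)
  have g: "g \<in> carrier G" "h \<in> carrier G" "k \<in> carrier G"
    using xyz by (simp_all add: e carrier_cocycle_extension)
  have "\<alpha> (g \<otimes> h, k) * (\<alpha> (g, h) * \<chi> \<alpha> * \<psi> \<alpha>) * \<xi> \<alpha>
      = \<alpha> (g, h \<otimes> k) * \<chi> \<alpha> * (\<alpha> (h, k) * \<psi> \<alpha> * \<xi> \<alpha>)" if "\<alpha> \<in> H" for \<alpha>
  proof -
    have "\<alpha> (g \<otimes> h, k) * (\<alpha> (g, h) * \<chi> \<alpha> * \<psi> \<alpha>) * \<xi> \<alpha>
        = (\<alpha> (g, h) * \<alpha> (g \<otimes> h, k)) * (\<chi> \<alpha> * \<psi> \<alpha> * \<xi> \<alpha>)" by (simp only: mult_ac)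
    then show ?thesis unfolding cocycle_groupD(3)[OF H_cocycle[OF that] g] by (simp only: mult_ac)
  qed
  then show "x \<otimes>\<^bsub>E\<^esub> y \<otimes>\<^bsub>E\<^esub> z = x \<otimes>\<^bsub>E\<^esub> (y \<otimes>\<^bsub>E\<^esub> z)"
    using g by (simp add: e mult_cocycle_extension m_assoc restrict_def fun_eq_iff)
next
  fix x assume x: "x \<in> carrier E"
  obtain g \<chi> where e: "x = (g, \<chi>)" by (cases x)
  have g: "g \<in> carrier G" and c: "\<chi> \<in> carrier dual"
    using x by (simp_all add: e carrier_cocycle_extension)
  show "\<one>\<^bsub>E\<^esub> \<otimes>\<^bsub>E\<^esub> x = x"
    using g c cocycle_one[OF H_cocycle g]
    by (auto simp: e one_cocycle_extension mult_cocycle_extension dual_iff fun_eq_iff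
        extensional_def restrict_def)
  \<comment> \<open>A left inverse over \<open>inv g\<close> must have a character
    \<open>\<psi>\<close> with
    \<open>\<alpha> (inv g, g) * \<psi> \<alpha> * \<chi> \<alpha> = 1\<close>; this is the inverse
    of \<open>\<mu>\<close> in the dual.\<close>
  define \<mu> where "\<mu> = (\<lambda>\<alpha>\<in>H. \<alpha> (inv g, g)) \<otimes>\<^bsub>dual\<^esub> \<chi>"
  let ?\<psi> = "inv\<^bsub>dual\<^esub> \<mu>"
  have m: "\<mu> \<in> carrier dual" using g c evaluation_in_dual by (simp add: \<mu>_def)
  have inv: "?\<psi> \<otimes>\<^bsub>dual\<^esub> \<mu> = \<one>\<^bsub>dual\<^esub>" using m by simp
  have "?\<psi> \<alpha> * \<mu> \<alpha> = 1" if "\<alpha> \<in> H" for \<alpha>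
    using that fun_cong[OF inv, of \<alpha>] by (simp add: character_group_ops)
  moreover have "\<mu> \<alpha> = \<alpha> (inv g, g) * \<chi> \<alpha>" if "\<alpha> \<in> H" for \<alpha>
    using that by (simp add: character_group_ops \<mu>_def)
  ultimately have "\<alpha> (inv g, g) * ?\<psi> \<alpha> * \<chi> \<alpha> = 1" if "\<alpha> \<in> H" for \<alpha>
    using that by (simp add: mult_ac)
  then have "(inv g, ?\<psi>) \<otimes>\<^bsub>E\<^esub> x = \<one>\<^bsub>E\<^esub>"
    using g by (simp add: e mult_cocycle_extension one_cocycle_extension restrict_def fun_eq_iff)
  moreover have "(inv g, ?\<psi>) \<in> carrier E"
    using g m by (simp add: carrier_cocycle_extension)
  ultimately show "\<exists>y\<in>carrier E. y \<otimes>\<^bsub>E\<^esub> x = \<one>\<^bsub>E\<^esub>" by blast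
qed

text \<open>For fixed \<open>\<alpha>\<close> in \<open>H\<close>, sending
  \<open>(g, \<chi>)\<close> to \<open>\<chi> \<alpha> * u g\<close> is multiplicative into the
  twisted group algebra, so powers pick up the cyclic product.\<close>

lemma extension_power:
  assumes g: "g \<in> carrier G" and c: "\<chi> \<in> carrier dual"
  shows "(g, \<chi>) [^]\<^bsub>E\<^esub> n = (g [^] n, \<lambda>\<alpha>\<in>H. cyclic_product G \<alpha> g n * \<chi> \<alpha> ^ n)"
proof (induction n)
  case 0
  then show ?case by (simp add: one_cocycle_extension restrict_def)
next
  case (Suc n)
  interpret E: group E by (rule group_extension)
  have "(g, \<chi>) [^]\<^bsub>E\<^esub> Suc n = (g, \<chi>) \<otimes>\<^bsub>E\<^esub> (g, \<chi>) [^]\<^bsub>E\<^esub> n"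
    using g c by (intro E.nat_pow_Suc2) (simp add: carrier_cocycle_extension)
  then show ?case
    using g unfolding Suc.IH
    by (simp add: mult_cocycle_extension restrict_def fun_eq_iff mult_ac flip: nat_pow_Suc2)
qed

lemma central_extension_cocycle_extension:
  assumes "finite (carrier G)" "finite H"
  shows "central_extension E fst G"
proof -
  have "finite (carrier dual)"
    using assms(2) H.subgroup_is_group[OF Z.is_group] by (intro finite_character_group) auto
  moreover have "fst \<in> hom E G"
    by (auto simp: hom_def carrier_cocycle_extension mult_cocycle_extension)
  moreover have "fst ` carrier E = carrier G"
    using one_dual by (force simp: carrier_cocycle_extension)
  moreover have "kernel E G fst \<subseteq> center E"
    by (auto simp: kernel_def center_def carrier_cocycle_extension mult_cocycle_extension
        cocycle_one[OF H_cocycle] fun_eq_iff restrict_def mult_ac)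
  ultimately show ?thesis
    using assms group_extension is_group
    by (simp add: central_extension_def epi_def carrier_cocycle_extension)
qed

end

section \<open>The unitary cover\<close>

lemma (in group) cocycle_subgroup_unitary:
  assumes "finite (carrier G)"
  shows "cocycle_subgroup G (unitary_cocycles G)"
  by (intro cocycle_subgroup.intro cocycle_subgroup_axioms.intro is_group
      subgroup_unitary_cocycles[OF assms])

lemma (in group) central_extension_unitary_cover:
  assumes "finite (carrier G)"
  shows "central_extension (unitary_cover G) fst G"
  unfolding unitary_cover_def
  by (rule cocycle_subgroup.central_extension_cocycle_extension[OF cocycle_subgroup_unitary])
    (use assms finite_unitary_cocycles in auto)

text \<open>The elements with trivial character and those over 1 given by evaluation at
  \<open>(x, y)\<close> yield the two conditions. Conversely, unitarity kills the cyclic product in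
  the power formula, and \<open>\<chi> \<alpha> ^ n = \<chi> (\<alpha> ^ n) = 1\<close>.\<close>

lemma (in group) exponent_unitary_cover_dvd_iff:
  assumes fin: "finite (carrier G)"
  shows "exponent (unitary_cover G) dvd n \<longleftrightarrow> (\<forall>g\<in>carrier G. g [^] n = \<one>) \<and>
    (\<forall>\<alpha>\<in>unitary_cocycles G. \<forall>x\<in>carrier G. \<forall>y\<in>carrier G. \<alpha> (x, y) ^ n = 1)"
proof -
  interpret cocycle_subgroup G "unitary_cocycles G" by (rule cocycle_subgroup_unitary[OF fin])
  interpret E: group E by (rule group_extension)
  show ?thesis unfolding unitary_cover_def E.exponent_dvd_iff
  proof (intro iffI conjI ballI)
    assume n: "\<forall>e\<in>carrier E. e [^]\<^bsub>E\<^esub> n = \<one>\<^bsub>E\<^esub>"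
    {
      fix g assume g: "g \<in> carrier G"
      have "(g, \<lambda>\<alpha>\<in>unitary_cocycles G. 1) \<in> carrier E"
        using g one_dual by (simp add: carrier_cocycle_extension)
      with n have "(g, \<lambda>\<alpha>\<in>unitary_cocycles G. 1) [^]\<^bsub>E\<^esub> n = \<one>\<^bsub>E\<^esub>" by blast
      then show "g [^] n = \<one>"
        by (simp add: extension_power[OF g one_dual] one_cocycle_extension)
    }
    {
      fix \<alpha> x y
      assume a: "\<alpha> \<in> unitary_cocycles G" and x: "x \<in> carrier G" and y: "y \<in> carrier G"
      note ev = evaluation_in_dual[OF x y]
      have "(\<one>, \<lambda>\<alpha>\<in>unitary_cocycles G. \<alpha> (x, y)) \<in> carrier E"
        using ev by (simp add: carrier_cocycle_extension)
      with n have "(\<one>, \<lambda>\<alpha>\<in>unitary_cocycles G. \<alpha> (x, y)) [^]\<^bsub>E\<^esub> n = \<one>\<^bsub>E\<^esub>" by blast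
      then have e: "(\<lambda>\<alpha>\<in>unitary_cocycles G. cyclic_product G \<alpha> \<one> n *
          (\<lambda>\<alpha>\<in>unitary_cocycles G. \<alpha> (x, y)) \<alpha> ^ n) = (\<lambda>\<alpha>\<in>unitary_cocycles G. 1)"
        unfolding extension_power[OF one_closed ev] one_cocycle_extension by simp
      show "\<alpha> (x, y) ^ n = 1"
        using fun_cong[OF e, of \<alpha>] a cyclic_product_one[OF H_cocycle[OF a]] by simp
    }
  next
    fix e
    assume n: "(\<forall>g\<in>carrier G. g [^] n = \<one>) \<and>
        (\<forall>\<alpha>\<in>unitary_cocycles G. \<forall>x\<in>carrier G. \<forall>y\<in>carrier G. \<alpha> (x, y) ^ n = 1)"
      and "e \<in> carrier E"
    then obtain g \<chi> where e: "e = (g, \<chi>)" and g: "g \<in> carrier G" and c: "\<chi> \<in> carrier dual"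
      by (auto simp: carrier_cocycle_extension)
    have "cyclic_product G \<alpha> g n * \<chi> \<alpha> ^ n = 1" if a: "\<alpha> \<in> unitary_cocycles G" for \<alpha>
    proof -
      have "\<alpha> [^]\<^bsub>cocycle_group G\<^esub> n = \<one>\<^bsub>cocycle_group G\<^esub>"
        using n a by (auto simp: cocycle_group_power[OF is_group H_cocycle[OF a]] cocycle_group_one
            fun_eq_iff restrict_def)
      then have "\<chi> \<alpha> ^ n = 1"
        using a by (intro character_power_eq_one[OF H.subgroup_is_group[OF Z.is_group] c])
          (simp_all flip: Z.nat_pow_consistent)
      then show ?thesis using a n g unitary_cocycles_iff[OF fin] by simp
    qed
    then show "e [^]\<^bsub>E\<^esub> n = \<one>\<^bsub>E\<^esub>"
      using n g by (simp add: e extension_power[OF g c] one_cocycle_extension restrict_def fun_eq_iff)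
  qed
qed

text \<open>For the section with trivial characters, the factor set at \<open>(g, h)\<close> is
  evaluation of cocycles at \<open>(g, h)\<close>. Evaluating kernel elements at a unitary
  \<open>\<beta>\<close> is a character, which therefore maps to the class of
  \<open>\<beta>\<close>, and every class has a unitary representative.\<close>

lemma (in group) projective_lifting_property_unitary_cover:
  assumes fin: "finite (carrier G)"
  shows "projective_lifting_property (unitary_cover G) fst G"
proof -
  interpret cocycle_subgroup G "unitary_cocycles G" by (rule cocycle_subgroup_unitary[OF fin])
  interpret E: group E by (rule group_extension)
  note ext = central_extension_unitary_cover[OF fin, unfolded unitary_cover_def]
  define \<phi> where "\<phi> g = (g, \<lambda>\<alpha>\<in>unitary_cocycles G. 1 :: complex)" for g :: 'a
  have sec: "is_section E fst G \<phi>"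
    using one_dual by (simp add: is_section_def \<phi>_def carrier_cocycle_extension one_cocycle_extension)
  let ?A = "kernel E G fst"
  have phiE: "\<phi> g \<in> carrier E" if "g \<in> carrier G" for g
    using sec that by (auto simp: is_section_def)
  have factor: "factor_set E G \<phi> g h = (\<one>, \<lambda>\<alpha>\<in>unitary_cocycles G. \<alpha> (g, h))"
    if g: "g \<in> carrier G" and h: "h \<in> carrier G" for g h
  proof -
    have "(\<one>, \<lambda>\<alpha>\<in>unitary_cocycles G. \<alpha> (g, h)) \<in> carrier E"
      using evaluation_in_dual[OF g h] by (simp add: carrier_cocycle_extension)
    \<comment> \<open>Checking the defining relation of the factor set avoids computing an inverse
      in the extension.\<close>
    moreover have "\<phi> g \<otimes>\<^bsub>E\<^esub> \<phi> h = (\<one>, \<lambda>\<alpha>\<in>unitary_cocycles G. \<alpha> (g, h)) \<otimes>\<^bsub>E\<^esub> \<phi> (g \<otimes> h)"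
      using g h by (auto simp: \<phi>_def mult_cocycle_extension cocycle_one[OF H_cocycle] fun_eq_iff restrict_def)
    ultimately show ?thesis
      using g h phiE by (simp add: factor_set_def E.m_assoc)
  qed
  have "standard_map E G \<phi> ` carrier (character_group (E\<lparr>carrier := ?A\<rparr>)) = carrier (schur_multiplier G)"
  proof
    show "standard_map E G \<phi> ` carrier (character_group (E\<lparr>carrier := ?A\<rparr>)) \<subseteq> carrier (schur_multiplier G)"
      using character_factor_set_in_cocycle_group[OF ext sec]
      by (auto simp: standard_map_def carrier_schur_multiplier)
  next
    show "carrier (schur_multiplier G) \<subseteq> standard_map E G \<phi> ` carrier (character_group (E\<lparr>carrier := ?A\<rparr>))"
    proof
      fix M assume "M \<in> carrier (schur_multiplier G)"
      then obtain \<alpha> where a: "\<alpha> \<in> carrier (cocycle_group G)" and M: "M = coboundaries G #>\<^bsub>cocycle_group G\<^esub> \<alpha>"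
        by (auto simp: carrier_schur_multiplier)
      obtain \<beta> \<zeta> where b: "\<beta> \<in> unitary_cocycles G" and z: "cohomologous G \<zeta> \<beta> \<alpha>"
        using ex_unitary_cohomologous[OF fin a] by blast
      define l where "l = (\<lambda>e\<in>?A. snd e \<beta>)"
      have "l \<in> carrier (character_group (E\<lparr>carrier := ?A\<rparr>))"
        unfolding character_group_iff
      proof (intro conjI ballI; simp)
        show "l \<in> extensional ?A" by (simp add: l_def)
        fix e assume e: "e \<in> ?A"
        then obtain \<chi> where x: "e = (\<one>, \<chi>)" "\<chi> \<in> carrier dual"
          by (auto simp: kernel_def carrier_cocycle_extension)
        then show "l e \<noteq> 0" using e b dual_iff by (simp add: l_def)
        fix e' assume e': "e' \<in> ?A"
        then obtain \<psi> where y: "e' = (\<one>, \<psi>)" "\<psi> \<in> carrier dual"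
          by (auto simp: kernel_def carrier_cocycle_extension)
        have "e \<otimes>\<^bsub>E\<^esub> e' \<in> ?A"
          using x y extension_closed[OF one_closed one_closed x(2) y(2)]
          by (simp add: kernel_def carrier_cocycle_extension mult_cocycle_extension)
        then show "l (e \<otimes>\<^bsub>E\<^esub> e') = l e * l e'"
          using e e' b x(1) y(1) cocycle_groupD(4)[OF H_cocycle[OF b]]
          by (simp add: l_def mult_cocycle_extension)
      qed
      moreover have "(\<lambda>(g, h)\<in>carrier G \<times> carrier G. l (factor_set E G \<phi> g h)) = \<beta>"
      proof
        fix p
        have "(\<one>, \<lambda>\<alpha>\<in>unitary_cocycles G. \<alpha> (g, h)) \<in> ?A" if "g \<in> carrier G" "h \<in> carrier G" for g h
          using evaluation_in_dual[OF that] by (simp add: kernel_def carrier_cocycle_extension)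
        then show "(\<lambda>(g, h)\<in>carrier G \<times> carrier G. l (factor_set E G \<phi> g h)) p = \<beta> p"
          using b extensional_arb[OF cocycle_groupD(1)[OF H_cocycle[OF b]], of p]
          by (cases p) (simp add: l_def factor)
      qed
      ultimately show "M \<in> standard_map E G \<phi> ` carrier (character_group (E\<lparr>carrier := ?A\<rparr>))"
        using z M cohomologous_rcos[OF is_group H_cocycle[OF b] a]
        by (auto simp: standard_map_def intro!: image_eqI[of _ _ l])
    qed
  qed
  with sec show ?thesis unfolding projective_lifting_property_def unitary_cover_def by blast
qed

section \<open>Minimality of the exponent\<close>

text \<open>By the lifting property a unitary \<open>\<alpha>\<close> is
  \<open>\<beta> \<delta>\<zeta>\<close>, with \<open>\<beta>\<close> the composite of the factor
  set and a character \<open>l\<close> of the kernel. The exponent of \<open>\<Gamma>\<close> kills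
  the values of \<open>l\<close>. It also kills each \<open>\<zeta> g\<close>, because the cyclic
  products of that length are 1 for both cocycles.\<close>

lemma (in group) exponent_unitary_cover_dvd_exponent:
  assumes fin: "finite (carrier G)"
    and ext: "central_extension \<Gamma> \<pi> G" and plp: "projective_lifting_property \<Gamma> \<pi> G"
  shows "exponent (unitary_cover G) dvd exponent \<Gamma>"
proof -
  have "group \<Gamma>" "\<pi> \<in> hom \<Gamma> G" using ext by (simp_all add: central_extension_def epi_def)
  then interpret \<pi>: group_hom \<Gamma> G \<pi>
    by (intro group_hom.intro group_hom_axioms.intro is_group)
  interpret A: subgroup "kernel \<Gamma> G \<pi>" \<Gamma> by (rule \<pi>.subgroup_kernel)
  let ?A = "kernel \<Gamma> G \<pi>" and ?n = "exponent \<Gamma>"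
  have n: "x [^]\<^bsub>\<Gamma>\<^esub> ?n = \<one>\<^bsub>\<Gamma>\<^esub>" if "x \<in> carrier \<Gamma>" for x
    using \<pi>.G.exponent_dvd_iff[of ?n] that by simp
  have surj: "\<pi> ` carrier \<Gamma> = carrier G" using ext by (simp add: central_extension_def epi_def)
  have gn: "g [^] ?n = \<one>" if "g \<in> carrier G" for g
  proof -
    have "g \<in> \<pi> ` carrier \<Gamma>" using that surj by simp
    then obtain x where x: "x \<in> carrier \<Gamma>" "g = \<pi> x" by (rule imageE)
    have "\<pi> (x [^]\<^bsub>\<Gamma>\<^esub> ?n) = \<pi> x [^] ?n" by (rule \<pi>.hom_nat_pow) (rule x(1))
    then show ?thesis unfolding n[OF x(1)] x(2) by simp
  qed
  obtain \<phi> where sec: "is_section \<Gamma> \<pi> G \<phi>"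
    and surj_std: "standard_map \<Gamma> G \<phi> ` carrier (character_group (\<Gamma>\<lparr>carrier := ?A\<rparr>))
      = carrier (schur_multiplier G)"
    using plp unfolding projective_lifting_property_def by blast
  have phi: "\<phi> g \<in> carrier \<Gamma>" if "g \<in> carrier G" for g
    using sec that by (auto simp: is_section_def)
  have "\<alpha> (x, y) ^ ?n = 1"
    if a: "\<alpha> \<in> unitary_cocycles G" and x: "x \<in> carrier G" and y: "y \<in> carrier G" for \<alpha> x y
  proof -
    have aZ: "\<alpha> \<in> carrier (cocycle_group G)" using a by (simp add: unitary_cocycles_def)
    then have "coboundaries G #>\<^bsub>cocycle_group G\<^esub> \<alpha> \<in> carrier (schur_multiplier G)"
      by (simp add: carrier_schur_multiplier)
    then obtain l where l: "l \<in> carrier (character_group (\<Gamma>\<lparr>carrier := ?A\<rparr>))"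
      and "coboundaries G #>\<^bsub>cocycle_group G\<^esub> \<alpha> = standard_map \<Gamma> G \<phi> l"
      using surj_std by (metis (no_types, lifting) imageE)
    define \<beta> where "\<beta> = (\<lambda>(g, h)\<in>carrier G \<times> carrier G. l (factor_set \<Gamma> G \<phi> g h))"
    have bZ: "\<beta> \<in> carrier (cocycle_group G)"
      unfolding \<beta>_def by (rule character_factor_set_in_cocycle_group[OF ext sec l])
    then obtain \<zeta> where z: "cohomologous G \<zeta> \<alpha> \<beta>"
      using cohomologous_rcos[OF is_group aZ bZ]
        \<open>coboundaries G #>\<^bsub>cocycle_group G\<^esub> \<alpha> = standard_map \<Gamma> G \<phi> l\<close>
      by (auto simp: standard_map_def \<beta>_def)
    \<comment> \<open>Here \<open>\<phi> g\<close> plays the part of \<open>u g\<close>: the factor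
      set values collected by its \<open>k\<close>-th power multiply to a kernel element
      \<open>c\<close>, on which \<open>l\<close> takes the cyclic product of \<open>\<beta>\<close>
      as its value.\<close>
    have pow: "\<exists>c\<in>?A. \<phi> g [^]\<^bsub>\<Gamma>\<^esub> k = c \<otimes>\<^bsub>\<Gamma>\<^esub> \<phi> (g [^] k) \<and> l c = cyclic_product G \<beta> g k"
      if g: "g \<in> carrier G" for g and k :: nat
    proof (induction k)
      case 0
      have "\<phi> \<one> = \<one>\<^bsub>\<Gamma>\<^esub>" using sec by (simp add: is_section_def)
      then show ?case
        using character_group_one[OF l] by (intro bexI[of _ "\<one>\<^bsub>\<Gamma>\<^esub>"]) auto
    next
      case (Suc k)
      then obtain c where c: "c \<in> ?A" "\<phi> g [^]\<^bsub>\<Gamma>\<^esub> k = c \<otimes>\<^bsub>\<Gamma>\<^esub> \<phi> (g [^] k)"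
        and lc: "l c = cyclic_product G \<beta> g k" by blast
      let ?w = "factor_set \<Gamma> G \<phi> g (g [^] k)"
      have w: "?w \<in> ?A" using factor_set_in_kernel[OF ext sec g] g by simp
      have cw: "c \<in> carrier \<Gamma>" "?w \<in> carrier \<Gamma>" using c(1) w A.subset by auto
      have "\<phi> g [^]\<^bsub>\<Gamma>\<^esub> Suc k = \<phi> g \<otimes>\<^bsub>\<Gamma>\<^esub> (c \<otimes>\<^bsub>\<Gamma>\<^esub> \<phi> (g [^] k))"
        unfolding \<pi>.G.nat_pow_Suc2[OF phi[OF g]] c(2) ..
      also have "\<dots> = c \<otimes>\<^bsub>\<Gamma>\<^esub> (\<phi> g \<otimes>\<^bsub>\<Gamma>\<^esub> \<phi> (g [^] k))"
      proof -
        have "c \<otimes>\<^bsub>\<Gamma>\<^esub> \<phi> g = \<phi> g \<otimes>\<^bsub>\<Gamma>\<^esub> c"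
          using ext c(1) phi[OF g] by (auto simp: central_extension_def center_def)
        then show ?thesis using cw phi g by (simp flip: \<pi>.G.m_assoc)
      qed
      also have "\<dots> = (c \<otimes>\<^bsub>\<Gamma>\<^esub> ?w) \<otimes>\<^bsub>\<Gamma>\<^esub> \<phi> (g [^] Suc k)"
        using factor_set_mult[OF ext sec g, of "g [^] k"] g cw phi
        by (simp add: \<pi>.G.m_assoc flip: nat_pow_Suc2)
      finally have "\<phi> g [^]\<^bsub>\<Gamma>\<^esub> Suc k = (c \<otimes>\<^bsub>\<Gamma>\<^esub> ?w) \<otimes>\<^bsub>\<Gamma>\<^esub> \<phi> (g [^] Suc k)" .
      moreover have "l ?w = \<beta> (g, g [^] k)" using g by (simp add: \<beta>_def)
      ultimately show ?case
        using character_group_mult(1)[OF l c(1) w] lc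
        by (intro bexI[of _ "c \<otimes>\<^bsub>\<Gamma>\<^esub> ?w"] conjI A.m_closed c(1) w) auto
    qed
    have "\<zeta> g ^ ?n = 1" if g: "g \<in> carrier G" for g
    proof -
      obtain c where c: "c \<in> ?A" "\<phi> g [^]\<^bsub>\<Gamma>\<^esub> ?n = c \<otimes>\<^bsub>\<Gamma>\<^esub> \<phi> (g [^] ?n)"
        and lc: "l c = cyclic_product G \<beta> g ?n" using pow[OF g] by blast
      have "\<phi> \<one> = \<one>\<^bsub>\<Gamma>\<^esub>" using sec by (simp add: is_section_def)
      \<comment> \<open>Both \<open>\<phi> g ^ ?n\<close> and \<open>\<phi> (g ^ ?n)\<close> are
        trivial, the latter by normalization of the section.\<close>
      then have "c = \<one>\<^bsub>\<Gamma>\<^esub>" using c gn[OF g] n[OF phi[OF g]] A.subset by auto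
      then have "cyclic_product G \<beta> g ?n = 1" using lc character_group_one[OF l] by simp
      moreover have "cyclic_product G \<alpha> g ?n = 1"
        using a g gn[OF g] unitary_cocycles_iff[OF fin] by blast
      ultimately show ?thesis
        using cyclic_product_cohomologous[OF z g, of ?n] gn[OF g] cohomologousD(2)[OF z] by simp
    qed
    then have "\<alpha> (x, y) ^ ?n = \<beta> (x, y) ^ ?n"
      using cohomologousD(3)[OF cohomologous_power[OF z, of ?n] x y] x y by simp
    also have "\<dots> = 1"
    proof -
      have w: "factor_set \<Gamma> G \<phi> x y \<in> ?A" by (rule factor_set_in_kernel[OF ext sec x y])
      then have "l (factor_set \<Gamma> G \<phi> x y) ^ ?n = 1"
        using n A.subset
        by (intro character_power_eq_one[OF A.subgroup_is_group[OF \<pi>.G.is_group] l])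
          (auto simp flip: \<pi>.G.nat_pow_consistent)
      then show ?thesis using x y by (simp add: \<beta>_def)
    qed
    finally show ?thesis .
  qed
  then show ?thesis using gn by (simp add: exponent_unitary_cover_dvd_iff[OF fin])
qed

lemma (in group) exponent_pos:
  assumes "finite (carrier G)"
  shows "exponent G > 0"
proof -
  have "exponent G dvd order G" by (simp add: exponent_dvd_iff pow_order_eq_1)
  then show ?thesis using assms order_gt_0_iff_finite by (metis dvd_0_left gr_zeroI less_irrefl)
qed

section \<open>Restriction and inflation\<close>

text \<open>Inflation when \<open>h\<close> is a quotient map, restriction when it is an inclusion
  or a splitting. The bounded abstraction keeps the result extensional, as cocycles have to
  be.\<close>

definition pullback ::
  "('a, 'b) monoid_scheme \<Rightarrow> ('a \<Rightarrow> 'c) \<Rightarrow> ('c \<times> 'c \<Rightarrow> complex) \<Rightarrow> 'a \<times> 'a \<Rightarrow> complex" where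
  "pullback G h \<alpha> = (\<lambda>(x, y)\<in>carrier G \<times> carrier G. \<alpha> (h x, h y))"

lemma pullback_apply [simp]:
  "\<lbrakk>x \<in> carrier G; y \<in> carrier G\<rbrakk> \<Longrightarrow> pullback G h \<alpha> (x, y) = \<alpha> (h x, h y)"
  by (simp add: pullback_def)

lemma (in group_hom) pullback_cocycle:
  assumes "\<alpha> \<in> carrier (cocycle_group H)"
  shows "pullback G h \<alpha> \<in> carrier (cocycle_group G)"
  by (rule cocycle_groupI)
    (use assms in \<open>simp_all add: pullback_def cocycle_groupD(2,4) cocycle_groupD(3)[OF assms]\<close>)

lemma (in group_hom) cyclic_product_pullback:
  assumes "g \<in> carrier G"
  shows "cyclic_product G (pullback G h \<alpha>) g n = cyclic_product H \<alpha> (h g) n"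
  using assms by (simp add: cyclic_product_def hom_nat_pow)

text \<open>Since \<open>g ^ n = 1\<close> gives \<open>h g ^ n = 1\<close>, unitarity on
  \<open>H\<close> applies to the cyclic product along \<open>h g\<close>, with the same
  \<open>n\<close>.\<close>

lemma (in group_hom) pullback_unitary:
  assumes "finite (carrier G)" "finite (carrier H)" "\<alpha> \<in> unitary_cocycles H"
  shows "pullback G h \<alpha> \<in> unitary_cocycles G"
proof -
  have "h g [^]\<^bsub>H\<^esub> n = \<one>\<^bsub>H\<^esub>" if "g \<in> carrier G" "g [^] n = \<one>" for g and n :: nat
    using that hom_nat_pow[of g n] by simp
  then show ?thesis
    using assms by (auto simp: G.unitary_cocycles_iff H.unitary_cocycles_iff pullback_cocycle
        cyclic_product_pullback)
qed

lemma (in group) restrict_unitary: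
  assumes fin: "finite (carrier G)" and K: "subgroup K G" and a: "\<alpha> \<in> unitary_cocycles G"
  shows "restrict \<alpha> (K \<times> K) \<in> unitary_cocycles (G\<lparr>carrier := K\<rparr>)"
proof -
  interpret K: subgroup K G by (rule K)
  have "group (G\<lparr>carrier := K\<rparr>)" by (rule K.subgroup_is_group) (rule is_group)
  then interpret i: group_hom "G\<lparr>carrier := K\<rparr>" G "\<lambda>x. x"
    by (intro group_hom.intro group_hom_axioms.intro is_group) (auto simp: hom_def)
  have "pullback (G\<lparr>carrier := K\<rparr>) (\<lambda>x. x) \<alpha> = restrict \<alpha> (K \<times> K)"
    by (simp add: pullback_def)
  then show ?thesis
    using i.pullback_unitary[OF _ fin a] finite_subset[OF K.subset fin] by simp
qed

lemma (in group_hom) mult_inv_in_kernel: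
  assumes "g \<in> carrier G" "k \<in> carrier G" "h g = h k"
  shows "inv k \<otimes> g \<in> kernel G H h" "g \<otimes> inv k \<in> kernel G H h"
  using assms by (simp_all add: kernel_def)

lemma (in group_hom) conjugate_in_kernel:
  assumes "x \<in> kernel G H h" "g \<in> carrier G"
  shows "inv g \<otimes> x \<otimes> g \<in> kernel G H h"
  using assms by (simp add: kernel_def)

text \<open>
  In the twisted group algebra of \<open>\<gamma>\<close> the hypotheses say that \<open>u x * u y = u (x y)\<close> and that
  \<open>u x * u g = u g * u (g\<^sup>-\<^sup>1 x g)\<close> for \<open>x\<close>, \<open>y\<close> in the kernel. Rescaling the basis so that
  \<open>w (t y) = u t * u y\<close> for \<open>t\<close> in the transversal and \<open>y\<close> in the kernel makes the cocycle
  constant on cosets of the kernel.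
\<close>

lemma (in group_hom) ex_inflation:
  assumes s: "\<And>p. p \<in> carrier H \<Longrightarrow> s p \<in> carrier G" "\<And>p. p \<in> carrier H \<Longrightarrow> h (s p) = p"
      "s \<one>\<^bsub>H\<^esub> = \<one>"
    and c: "\<gamma> \<in> carrier (cocycle_group G)"
    and triv: "\<And>x y. \<lbrakk>x \<in> kernel G H h; y \<in> kernel G H h\<rbrakk> \<Longrightarrow> \<gamma> (x, y) = 1"
    and conj: "\<And>x g. \<lbrakk>x \<in> kernel G H h; g \<in> carrier G\<rbrakk> \<Longrightarrow> \<gamma> (x, g) = \<gamma> (g, inv g \<otimes> x \<otimes> g)"
  shows "\<exists>\<beta> \<zeta>. \<beta> \<in> carrier (cocycle_group H) \<and>
    cohomologous G \<zeta> \<gamma> (pullback G h \<beta>) \<and> (\<forall>x\<in>kernel G H h. \<zeta> x = 1) \<and>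
    (\<forall>p\<in>carrier H. \<forall>q\<in>carrier H. s (p \<otimes>\<^bsub>H\<^esub> q) = s p \<otimes> s q \<longrightarrow> \<beta> (p, q) = \<gamma> (s p, s q))"
proof -
  let ?N = "kernel G H h"
  have N: "x \<in> carrier G" "h x = \<one>\<^bsub>H\<^esub>" if "x \<in> ?N" for x using that by (auto simp: kernel_def)
  interpret N: subgroup ?N G by (rule subgroup_kernel)
  \<comment> \<open>Writing \<open>g = t * y\<close> with \<open>t\<close> its representative and
    \<open>y\<close> in the kernel, \<open>\<eta> g\<close> is the scalar with
    \<open>u t * u y = \<eta> g * u g\<close>.\<close>
  define \<eta> where "\<eta> g = \<gamma> (s (h g), inv (s (h g)) \<otimes> g)" for g
  have eta_nz: "\<eta> g \<noteq> 0" if "g \<in> carrier G" for g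
    using that s by (simp add: \<eta>_def cocycle_groupD(2)[OF c])
  have eta_N: "\<eta> x = 1" if "x \<in> ?N" for x
    using N[OF that] s(3) by (simp add: \<eta>_def G.cocycle_one[OF c])
  have eta_s: "\<eta> (s p) = 1" if "p \<in> carrier H" for p
    using that s by (simp add: \<eta>_def G.cocycle_one[OF c])
  \<comment> \<open>Since \<open>u y * u x = u (y * x)\<close> in the kernel,
    \<open>u t * u (y * x) = (u t * u y) * u x = \<eta> g * u g * u x\<close>.\<close>
  have eta_mult: "\<eta> (g \<otimes> x) = \<gamma> (g, x) * \<eta> g" if g: "g \<in> carrier G" and x: "x \<in> ?N" for g x
  proof -
    let ?t = "s (h g)"
    have t: "?t \<in> carrier G" "h ?t = h g" using g s by simp_all
    have y: "inv ?t \<otimes> g \<in> ?N" by (rule mult_inv_in_kernel) (use g t in simp_all)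
    have e: "?t \<otimes> (inv ?t \<otimes> g) = g" using g t by (simp flip: G.m_assoc)
    have "\<eta> (g \<otimes> x) = \<gamma> (?t, inv ?t \<otimes> g \<otimes> x)"
      using g N[OF x] t by (simp add: \<eta>_def G.m_assoc)
    then show ?thesis
      using cocycle_groupD(3)[OF c t(1) N(1)[OF y] N(1)[OF x]] triv[OF y x]
      by (simp add: e \<eta>_def mult.commute)
  qed
  \<comment> \<open>\<open>\<gamma>'\<close> is the cocycle of the rescaled basis
    \<open>w g = \<eta> g * u g\<close>. Next it is shown to be 1 as soon as one argument lies in
    the kernel.\<close>
  obtain \<gamma>' where c': "\<gamma>' \<in> carrier (cocycle_group G)" and coh: "cohomologous G \<eta> \<gamma>' \<gamma>"
    using G.ex_cohomologous_cocycle[of \<gamma> \<eta>, OF c eta_nz eta_N[OF N.one_closed]] by blast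
  have right: "\<gamma>' (g, x) = 1" if "g \<in> carrier G" "x \<in> ?N" for g x
    using cohomologousD(3)[OF coh that(1) N(1)[OF that(2)]] eta_mult[OF that] eta_N[OF that(2)]
      eta_nz[OF that(1)] cocycle_groupD(2)[OF c that(1) N(1)[OF that(2)]]
    by simp
  have left: "\<gamma>' (x, g) = 1" if g: "g \<in> carrier G" and x: "x \<in> ?N" for g x
  proof -
    let ?x = "inv g \<otimes> x \<otimes> g"
    have x': "?x \<in> ?N" by (rule conjugate_in_kernel[OF x g])
    have "g \<otimes> ?x = x \<otimes> g" using g N[OF x] by (simp flip: G.m_assoc)
    then have "\<eta> (x \<otimes> g) = \<gamma> (x, g) * \<eta> g" using eta_mult[OF g x'] conj[OF x g] by simp
    then show ?thesis
      using cohomologousD(3)[OF coh N(1)[OF x] g] eta_N[OF x] eta_nz[OF g]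
        cocycle_groupD(2)[OF c N(1)[OF x] g]
      by simp
  qed
  \<comment> \<open>The cocycle identities at \<open>(?x, g', k')\<close> and
    \<open>(g, k', ?y)\<close> absorb kernel elements into either argument, because
    \<open>\<gamma>'\<close> is trivial against the kernel on both sides.\<close>
  have const: "\<gamma>' (g, k) = \<gamma>' (g', k')"
    if g: "g \<in> carrier G" "g' \<in> carrier G" "h g = h g'"
      and k: "k \<in> carrier G" "k' \<in> carrier G" "h k = h k'" for g g' k k'
  proof -
    let ?x = "g \<otimes> inv g'" and ?y = "inv k' \<otimes> k"
    have x: "?x \<in> ?N" and y: "?y \<in> ?N" by (rule mult_inv_in_kernel; use g k in simp)+
    have e: "?x \<otimes> g' = g" "k' \<otimes> ?y = k"
      using g k by (simp_all add: G.m_assoc) (simp flip: G.m_assoc)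
    have "\<gamma>' (g', k') = \<gamma>' (g, k')"
      using cocycle_groupD(3)[OF c' N(1)[OF x] g(2) k(2)] left[OF g(2) x]
        left[of "g' \<otimes> k'" ?x] x g k e(1) by simp
    also have "\<dots> = \<gamma>' (g, k)"
      using cocycle_groupD(3)[OF c' g(1) k(2) N(1)[OF y]] right[OF k(2) y]
        right[of "g \<otimes> k'" ?y] y g k e(2) by simp
    finally show ?thesis ..
  qed
  define \<beta> where "\<beta> = (\<lambda>(p, q)\<in>carrier H \<times> carrier H. \<gamma>' (s p, s q))"
  have b: "\<beta> \<in> carrier (cocycle_group H)"
  proof (rule cocycle_groupI)
    fix p q r assume p: "p \<in> carrier H" and q: "q \<in> carrier H" and r: "r \<in> carrier H"
    have "\<gamma>' (s (p \<otimes>\<^bsub>H\<^esub> q), s r) = \<gamma>' (s p \<otimes> s q, s r)"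
      "\<gamma>' (s p, s (q \<otimes>\<^bsub>H\<^esub> r)) = \<gamma>' (s p, s q \<otimes> s r)"
      using p q r s by (auto intro!: const)
    then show "\<beta> (p, q) * \<beta> (p \<otimes>\<^bsub>H\<^esub> q, r) = \<beta> (p, q \<otimes>\<^bsub>H\<^esub> r) * \<beta> (q, r)"
      using cocycle_groupD(3)[OF c', of "s p" "s q" "s r"] p q r s by (simp add: \<beta>_def)
  qed (use s c' in \<open>simp_all add: \<beta>_def cocycle_groupD(2,4)\<close>)
  have "\<gamma>' (x, y) = pullback G h \<beta> (x, y)" if "x \<in> carrier G" "y \<in> carrier G" for x y
    using that s by (auto simp: \<beta>_def intro!: const)
  then have "cohomologous G (\<lambda>x. inverse (\<eta> x)) \<gamma> (pullback G h \<beta>)"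
    by (intro cohomologous_cong[OF G.cohomologous_sym[OF coh]]) auto
  \<comment> \<open>Representatives are not rescaled, so the values of \<open>\<gamma>\<close>
    survive where \<open>s\<close> is multiplicative. This identifies the inflated cocycle in the
    split case.\<close>
  moreover have "\<beta> (p, q) = \<gamma> (s p, s q)"
    if "p \<in> carrier H" "q \<in> carrier H" "s (p \<otimes>\<^bsub>H\<^esub> q) = s p \<otimes> s q" for p q
    using cohomologousD(3)[OF coh s(1)[OF that(1)] s(1)[OF that(2)]]
      eta_s[OF that(1)] eta_s[OF that(2)] eta_s[of "p \<otimes>\<^bsub>H\<^esub> q"] that by (simp add: \<beta>_def)
  ultimately show ?thesis using b eta_N by (intro exI[of _ \<beta>] exI[of _ "\<lambda>x. inverse (\<eta> x)"]) auto
qed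

section \<open>Powers of unitary cocycles relative to a normal subgroup\<close>

text \<open>The map \<open>s\<close> is a normalized transversal and in general no homomorphism.
  Allowing any multiple \<open>n\<close> of the exponent of the cover of the kernel permits the
  choice of an lcm for semidirect products.\<close>

locale finite_epi = group_hom +
  fixes s n
  assumes fin: "finite (carrier G)"
    and section_closed: "\<And>p. p \<in> carrier H \<Longrightarrow> s p \<in> carrier G"
    and section_hom: "\<And>p. p \<in> carrier H \<Longrightarrow> h (s p) = p"
    and section_one: "s \<one>\<^bsub>H\<^esub> = \<one>"
    and n: "exponent (unitary_cover (G\<lparr>carrier := kernel G H h\<rparr>)) dvd n"
begin

lemma fin_H: "finite (carrier H)"
proof -
  have "carrier H \<subseteq> h ` carrier G" using section_closed section_hom by force
  then show ?thesis using fin finite_surj by blast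
qed

text \<open>A unitary cocycle of \<open>G\<close> restricts to a unitary cocycle of the kernel,
  whose values are killed by \<open>n\<close>.\<close>

lemma kernel_power: "x \<in> kernel G H h \<Longrightarrow> x [^] n = \<one>"
  and unitary_power_kernel:
    "\<lbrakk>\<alpha> \<in> unitary_cocycles G; x \<in> kernel G H h; y \<in> kernel G H h\<rbrakk> \<Longrightarrow> \<alpha> (x, y) ^ n = 1"
proof -
  interpret N: subgroup "kernel G H h" G by (rule subgroup_kernel)
  interpret K: group "G\<lparr>carrier := kernel G H h\<rparr>" by (rule N.subgroup_is_group) (rule G.is_group)
  have "finite (kernel G H h)" using N.subset fin finite_subset by blast
  then have *: "(\<forall>g\<in>kernel G H h. g [^]\<^bsub>G\<lparr>carrier := kernel G H h\<rparr>\<^esub> n = \<one>) \<and>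
      (\<forall>\<alpha>\<in>unitary_cocycles (G\<lparr>carrier := kernel G H h\<rparr>).
         \<forall>x\<in>kernel G H h. \<forall>y\<in>kernel G H h. \<alpha> (x, y) ^ n = 1)"
    using n K.exponent_unitary_cover_dvd_iff[of n] by simp
  then show "x \<in> kernel G H h \<Longrightarrow> x [^] n = \<one>"
    by (simp flip: G.nat_pow_consistent)
  assume "\<alpha> \<in> unitary_cocycles G" "x \<in> kernel G H h" "y \<in> kernel G H h"
  then show "\<alpha> (x, y) ^ n = 1"
    using * G.restrict_unitary[OF fin N.subgroup_axioms] by force
qed

text \<open>
  The scalar relates \<open>u g ^ k\<close> to \<open>u (g ^ k)\<close>, and the \<open>n\<close>-th powers of both are 1
  because \<open>g ^ k\<close> lies in the kernel.
\<close>

lemma cyclic_product_power: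
  assumes a: "\<alpha> \<in> unitary_cocycles G" and g: "g \<in> carrier G" and k: "h g [^]\<^bsub>H\<^esub> k = \<one>\<^bsub>H\<^esub>"
  shows "cyclic_product G \<alpha> g k ^ n = 1"
proof -
  have aZ: "\<alpha> \<in> carrier (cocycle_group G)" using a by (simp add: unitary_cocycles_def)
  have "g [^] k \<in> kernel G H h" using g k by (simp add: kernel_def hom_nat_pow)
  then have 1: "(g [^] k) [^] n = \<one>" by (rule kernel_power)
  then have "cyclic_product G \<alpha> g (k * n) = 1" "cyclic_product G \<alpha> (g [^] k) n = 1"
    using a g G.unitary_cocycles_iff[OF fin] by (simp_all add: G.nat_pow_pow)
  then show ?thesis using G.cyclic_product_mult[OF aZ g, of k n] by simp
qed

text \<open>With \<open>y = inv g * x * g\<close>, the factor \<open>f\<close> in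
  \<open>u x * u g = f * u g * u y\<close> satisfies
  \<open>u x ^ n * u g = f ^ n * u g * u y ^ n\<close>, and both \<open>n\<close>-th powers are 1 by
  unitarity.\<close>

lemma unitary_power_conjugate:
  assumes a: "\<alpha> \<in> unitary_cocycles G" and x: "x \<in> kernel G H h" and g: "g \<in> carrier G"
  shows "\<alpha> (x, g) ^ n = \<alpha> (g, inv g \<otimes> x \<otimes> g) ^ n"
proof -
  have aZ: "\<alpha> \<in> carrier (cocycle_group G)" using a by (simp add: unitary_cocycles_def)
  let ?y = "inv g \<otimes> x \<otimes> g"
  have xG: "x \<in> carrier G" using x by (simp add: kernel_def)
  have y: "?y \<in> kernel G H h" by (rule conjugate_in_kernel[OF x g])
  then have yG: "?y \<in> carrier G" by (simp add: kernel_def)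
  have e: "x \<otimes> g = g \<otimes> ?y" using g xG by (simp flip: G.m_assoc)
  define f where "f = \<alpha> (x, g) / \<alpha> (g, ?y)"
  have f: "\<alpha> (x, g) = f * \<alpha> (g, ?y)" using cocycle_groupD(2)[OF aZ g yG] by (simp add: f_def)
  have "cyclic_product G \<alpha> x n = 1" "cyclic_product G \<alpha> ?y n = 1"
    using a xG yG kernel_power[OF x] kernel_power[OF y] G.unitary_cocycles_iff[OF fin] by auto
  then have "f ^ n = 1"
    using G.cyclic_product_conjugate[OF aZ xG yG g e f, of n] kernel_power[OF x] kernel_power[OF y]
    by (simp add: G.cocycle_one[OF aZ g])
  then show ?thesis unfolding f by (simp add: power_mult_distrib)
qed

text \<open>Raising to the \<open>n\<close>-th power makes the cocycle trivial on the kernel and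
  compatible with conjugation, as \<open>ex_inflation\<close> requires.\<close>

lemma ex_inflation_power:
  assumes a: "\<alpha> \<in> unitary_cocycles G"
  shows "\<exists>\<beta> \<zeta>. \<beta> \<in> carrier (cocycle_group H) \<and>
    cohomologous G \<zeta> (\<lambda>p. \<alpha> p ^ n) (pullback G h \<beta>) \<and> (\<forall>x\<in>kernel G H h. \<zeta> x = 1) \<and>
    (\<forall>p\<in>carrier H. \<forall>q\<in>carrier H. s (p \<otimes>\<^bsub>H\<^esub> q) = s p \<otimes> s q \<longrightarrow> \<beta> (p, q) = \<alpha> (s p, s q) ^ n)"
proof -
  have aZ: "\<alpha> \<in> carrier (cocycle_group G)" using a by (simp add: unitary_cocycles_def)
  define \<gamma> where "\<gamma> = (\<lambda>p\<in>carrier G \<times> carrier G. \<alpha> p ^ n)"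
  have c: "\<gamma> \<in> carrier (cocycle_group G)"
    unfolding \<gamma>_def by (rule cocycle_power_closed[OF G.is_group aZ])
  have g: "\<gamma> (x, y) = \<alpha> (x, y) ^ n" if "x \<in> carrier G" "y \<in> carrier G" for x y
    using that by (simp add: \<gamma>_def)
  have N: "x \<in> carrier G" if "x \<in> kernel G H h" for x using that by (simp add: kernel_def)
  obtain \<beta> \<zeta> where bz: "\<beta> \<in> carrier (cocycle_group H)" "\<forall>x\<in>kernel G H h. \<zeta> x = 1"
    and coh: "cohomologous G \<zeta> \<gamma> (pullback G h \<beta>)"
    and split: "\<forall>p\<in>carrier H. \<forall>q\<in>carrier H. s (p \<otimes>\<^bsub>H\<^esub> q) = s p \<otimes> s q \<longrightarrow> \<beta> (p, q) = \<gamma> (s p, s q)"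
    using ex_inflation[OF section_closed section_hom section_one c]
      unitary_power_kernel[OF a] unitary_power_conjugate[OF a] N
    by (auto simp: g)
  show ?thesis
    using bz split section_closed cohomologous_cong[OF coh, of "\<lambda>p. \<alpha> p ^ n" "pullback G h \<beta>"]
    by (intro exI[of _ \<beta>] exI[of _ \<zeta>]) (simp add: g)
qed

end

section \<open>Exponent bounds for a normal subgroup\<close>

text \<open>Every class has a unitary representative, and powers of cohomologous cocycles are
  cohomologous.\<close>

lemma (in group) exponent_schur_multiplier_dvdI:
  assumes fin: "finite (carrier G)"
    and u: "\<And>\<alpha>. \<alpha> \<in> unitary_cocycles G \<Longrightarrow> \<exists>\<zeta>. cohomologous G \<zeta> (\<lambda>p. \<alpha> p ^ n) (\<lambda>_. 1)"
  shows "exponent (schur_multiplier G) dvd n"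
  unfolding exponent_schur_multiplier_dvd_iff[OF is_group]
proof
  fix \<alpha> assume "\<alpha> \<in> carrier (cocycle_group G)"
  then obtain \<beta> \<zeta> where b: "\<beta> \<in> unitary_cocycles G" and z: "cohomologous G \<zeta> \<beta> \<alpha>"
    using ex_unitary_cohomologous[OF fin] by blast
  obtain \<xi> where "cohomologous G \<xi> (\<lambda>p. \<beta> p ^ n) (\<lambda>_. 1)" using u[OF b] by blast
  then show "\<exists>\<zeta>. cohomologous G \<zeta> (\<lambda>p. \<alpha> p ^ n) (\<lambda>_. 1)"
    using cohomologous_trans[OF cohomologous_sym[OF cohomologous_power[OF z, of n]]] by blast
qed

context finite_epi
begin

lemma exponent_schur_multiplier_dvd:
  assumes m: "exponent (schur_multiplier H) dvd m"
  shows "exponent (schur_multiplier G) dvd n * m"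
proof (rule G.exponent_schur_multiplier_dvdI[OF fin])
  fix \<alpha> assume "\<alpha> \<in> unitary_cocycles G"
  then obtain \<beta> \<zeta> where b: "\<beta> \<in> carrier (cocycle_group H)"
    and z: "cohomologous G \<zeta> (\<lambda>p. \<alpha> p ^ n) (pullback G h \<beta>)"
    using ex_inflation_power by blast
  obtain \<xi> where x: "cohomologous H \<xi> (\<lambda>p. \<beta> p ^ m) (\<lambda>_. 1)"
    using m b unfolding exponent_schur_multiplier_dvd_iff[OF H.is_group] by blast
  have "cohomologous G (\<xi> \<circ> h) (\<lambda>p. pullback G h \<beta> p ^ m) (\<lambda>_. 1)"
    by (rule cohomologous_cong[OF cohomologous_inflation[OF x]]) simp_all
  from G.cohomologous_trans[OF cohomologous_power[OF z, of m] this]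
  show "\<exists>\<zeta>. cohomologous G \<zeta> (\<lambda>p. \<alpha> p ^ (n * m)) (\<lambda>_. 1)"
    unfolding power_mult by blast
qed

text \<open>Along the first \<open>k\<close> powers of \<open>g\<close> both cyclic products are 1:
  for \<open>\<alpha> ^ n\<close> by \<open>cyclic_product_power\<close>, for the inflation by
  unitarity on \<open>H\<close>. What remains is \<open>\<zeta> (g ^ k) = \<zeta> g ^ k\<close>, and
  \<open>g ^ k\<close> lies in the kernel.\<close>

lemma rescaling_power:
  assumes a: "\<alpha> \<in> unitary_cocycles G" and b: "\<beta> \<in> unitary_cocycles H"
    and z: "cohomologous G \<zeta> (\<lambda>p. \<alpha> p ^ n) (pullback G h \<beta>)"
    and z1: "\<And>x. x \<in> kernel G H h \<Longrightarrow> \<zeta> x = 1"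
    and g: "g \<in> carrier G" and k: "h g [^]\<^bsub>H\<^esub> k = \<one>\<^bsub>H\<^esub>"
  shows "\<zeta> g ^ k = 1"
proof -
  have "cyclic_product G (\<lambda>p. \<alpha> p ^ n) g k = cyclic_product G \<alpha> g k ^ n"
    by (simp add: cyclic_product_def prod_power_distrib)
  also have "\<dots> = 1" by (rule cyclic_product_power[OF a g k])
  finally have "cyclic_product G (\<lambda>p. \<alpha> p ^ n) g k = 1" .
  moreover have "cyclic_product G (pullback G h \<beta>) g k = 1"
    using b g k H.unitary_cocycles_iff[OF fin_H] by (simp add: cyclic_product_pullback)
  moreover have "g [^] k \<in> kernel G H h" using g k by (simp add: kernel_def hom_nat_pow)
  ultimately show ?thesis
    using G.cyclic_product_cohomologous[OF z g, of k] z1 by simp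
qed

lemma power_eq_one:
  assumes "g \<in> carrier G" "h g [^]\<^bsub>H\<^esub> m = \<one>\<^bsub>H\<^esub>"
  shows "g [^] (n * m) = \<one>"
proof -
  have "g [^] m \<in> kernel G H h" using assms by (simp add: kernel_def hom_nat_pow)
  then have "(g [^] m) [^] n = \<one>" by (rule kernel_power)
  then show ?thesis using assms(1) by (simp add: G.nat_pow_pow mult.commute)
qed

lemma exponent_unitary_cover_dvd:
  assumes "exponent (unitary_cover H) dvd m"
  shows "exponent (unitary_cover G) dvd n * m"
proof -
  have hm: "q [^]\<^bsub>H\<^esub> m = \<one>\<^bsub>H\<^esub>" if "q \<in> carrier H" for q
    using assms that H.exponent_unitary_cover_dvd_iff[OF fin_H, of m] by simp
  have um: "\<beta> (p, q) ^ m = 1"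
    if "\<beta> \<in> unitary_cocycles H" "p \<in> carrier H" "q \<in> carrier H" for \<beta> p q
    using assms that H.exponent_unitary_cover_dvd_iff[OF fin_H, of m] by simp
  have "\<alpha> (x, y) ^ (n * m) = 1"
    if a: "\<alpha> \<in> unitary_cocycles G" and x: "x \<in> carrier G" and y: "y \<in> carrier G" for \<alpha> x y
  proof -
    obtain \<beta>\<^sub>0 \<zeta>\<^sub>0 where b0: "\<beta>\<^sub>0 \<in> carrier (cocycle_group H)" "\<forall>x\<in>kernel G H h. \<zeta>\<^sub>0 x = 1"
      and z0: "cohomologous G \<zeta>\<^sub>0 (\<lambda>p. \<alpha> p ^ n) (pullback G h \<beta>\<^sub>0)"
      using ex_inflation_power[OF a] by blast
    \<comment> \<open>The cocycle \<open>\<beta>\<^sub>0\<close> may fail to be unitary. Making it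
      so multiplies the rescaling by an inflated function, which is 1 on the kernel because it is
      normalized.\<close>
    obtain \<beta> \<xi> where b: "\<beta> \<in> unitary_cocycles H" and z: "cohomologous H \<xi> \<beta> \<beta>\<^sub>0"
      using H.ex_unitary_cohomologous[OF fin_H b0(1)] by blast
    define \<zeta> where "\<zeta> g = \<zeta>\<^sub>0 g * inverse (\<xi> (h g))" for g
    have "cohomologous G ((\<lambda>q. inverse (\<xi> q)) \<circ> h) (pullback G h \<beta>\<^sub>0) (pullback G h \<beta>)"
      by (rule cohomologous_cong[OF cohomologous_inflation[OF H.cohomologous_sym[OF z]]]) simp_all
    from G.cohomologous_trans[OF z0 this]
    have zeta: "cohomologous G \<zeta> (\<lambda>p. \<alpha> p ^ n) (pullback G h \<beta>)"
      by (simp add: \<zeta>_def[abs_def])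
    have "\<zeta> u = 1" if "u \<in> kernel G H h" for u
      using that b0(2) cohomologousD(2)[OF z] by (auto simp: \<zeta>_def kernel_def)
    then have "\<zeta> g ^ m = 1" if "g \<in> carrier G" for g
      using that by (intro rescaling_power[OF a b zeta]) (simp_all add: hm)
    then show ?thesis
      using cohomologousD(3)[OF cohomologous_power[OF zeta, of m] x y] x y um[OF b]
      by (simp add: power_mult)
  qed
  then show ?thesis
    using power_eq_one hm by (simp add: G.exponent_unitary_cover_dvd_iff[OF fin])
qed

end

section \<open>Exponent bounds for a semidirect product\<close>

locale finite_split_epi = finite_epi +
  assumes section_mult:
    "\<And>p q. \<lbrakk>p \<in> carrier H; q \<in> carrier H\<rbrakk> \<Longrightarrow> s (p \<otimes>\<^bsub>H\<^esub> q) = s p \<otimes> s q"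
begin

sublocale split: group_hom H G s
  by (intro group_hom.intro group_hom_axioms.intro homI H.is_group G.is_group
      section_closed section_mult)

text \<open>Multiplicativity of \<open>s\<close> makes the last clause of
  \<open>ex_inflation_power\<close> apply to all pairs, which determines
  \<open>\<beta>\<close>.\<close>

lemma ex_inflation_split:
  assumes a: "\<alpha> \<in> unitary_cocycles G"
  shows "\<exists>\<zeta>. cohomologous G \<zeta> (\<lambda>p. \<alpha> p ^ n) (pullback G h (\<lambda>p. pullback H s \<alpha> p ^ n)) \<and>
    (\<forall>x\<in>kernel G H h. \<zeta> x = 1)"
proof -
  obtain \<beta> \<zeta> where z: "cohomologous G \<zeta> (\<lambda>p. \<alpha> p ^ n) (pullback G h \<beta>)"
    and z1: "\<forall>x\<in>kernel G H h. \<zeta> x = 1"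
    and "\<forall>p\<in>carrier H. \<forall>q\<in>carrier H. s (p \<otimes>\<^bsub>H\<^esub> q) = s p \<otimes> s q \<longrightarrow> \<beta> (p, q) = \<alpha> (s p, s q) ^ n"
    using ex_inflation_power[OF a] by blast
  then have b: "\<beta> (p, q) = pullback H s \<alpha> (p, q) ^ n" if "p \<in> carrier H" "q \<in> carrier H" for p q
    using that section_mult by simp
  have "cohomologous G \<zeta> (\<lambda>p. \<alpha> p ^ n) (pullback G h (\<lambda>p. pullback H s \<alpha> p ^ n))"
    by (rule cohomologous_cong[OF z]) (simp_all add: b)
  with z1 show ?thesis by blast
qed

text \<open>The inflated cocycle is itself an \<open>n\<close>-th power, so the \<open>n\<close>
  that trivializes the kernel part also kills the class on the complement. Hence an lcm instead of a
  product.\<close>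

lemma exponent_schur_multiplier_dvd_split:
  assumes m: "exponent (schur_multiplier H) dvd n"
  shows "exponent (schur_multiplier G) dvd n"
proof (rule G.exponent_schur_multiplier_dvdI[OF fin])
  fix \<alpha> assume a: "\<alpha> \<in> unitary_cocycles G"
  then obtain \<zeta> where z: "cohomologous G \<zeta> (\<lambda>p. \<alpha> p ^ n) (pullback G h (\<lambda>p. pullback H s \<alpha> p ^ n))"
    using ex_inflation_split by blast
  have "\<alpha> \<in> carrier (cocycle_group G)" using a by (simp add: unitary_cocycles_def)
  then have "pullback H s \<alpha> \<in> carrier (cocycle_group H)" by (rule split.pullback_cocycle)
  then obtain \<xi> where x: "cohomologous H \<xi> (\<lambda>p. pullback H s \<alpha> p ^ n) (\<lambda>_. 1)"
    using m unfolding exponent_schur_multiplier_dvd_iff[OF H.is_group] by blast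
  have "cohomologous G (\<xi> \<circ> h) (pullback G h (\<lambda>p. pullback H s \<alpha> p ^ n)) (\<lambda>_. 1)"
    by (rule cohomologous_cong[OF cohomologous_inflation[OF x]]) simp_all
  from G.cohomologous_trans[OF z this]
  show "\<exists>\<zeta>. cohomologous G \<zeta> (\<lambda>p. \<alpha> p ^ n) (\<lambda>_. 1)" by blast
qed

text \<open>The restriction of \<open>\<alpha>\<close> to \<open>H\<close> and its
  \<open>n\<close>-th power are unitary, so \<open>\<zeta> g ^ e = 1\<close> follows from
  \<open>q ^ e = 1\<close> on \<open>H\<close>. The cofactor \<open>r\<close> lets
  \<open>n * e * r\<close> be any common multiple of \<open>n * e\<close> and the exponent of the
  cover of \<open>H\<close>.\<close>

lemma exponent_unitary_cover_dvd_split: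
  assumes e: "\<And>q. q \<in> carrier H \<Longrightarrow> q [^]\<^bsub>H\<^esub> e = \<one>\<^bsub>H\<^esub>"
    and r: "exponent (unitary_cover H) dvd n * e * r"
  shows "exponent (unitary_cover G) dvd n * e * r"
proof -
  have "\<alpha> (x, y) ^ (n * e * r) = 1"
    if a: "\<alpha> \<in> unitary_cocycles G" and x: "x \<in> carrier G" and y: "y \<in> carrier G" for \<alpha> x y
  proof -
    obtain \<zeta> where z: "cohomologous G \<zeta> (\<lambda>p. \<alpha> p ^ n) (pullback G h (\<lambda>p. pullback H s \<alpha> p ^ n))"
      and z1: "\<forall>x\<in>kernel G H h. \<zeta> x = 1"
      using ex_inflation_split[OF a] by blast
    let ?\<beta> = "pullback H s \<alpha>" and ?\<gamma> = "\<lambda>p\<in>carrier H \<times> carrier H. pullback H s \<alpha> p ^ n"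
    have b: "?\<beta> \<in> unitary_cocycles H" by (rule split.pullback_unitary[OF fin_H fin a])
    have U: "subgroup (unitary_cocycles H) (cocycle_group H)"
      by (rule H.subgroup_unitary_cocycles[OF fin_H])
    interpret Z: comm_group "cocycle_group H" by (rule comm_group_cocycle_group) (rule H.is_group)
    interpret U: group "cocycle_group H\<lparr>carrier := unitary_cocycles H\<rparr>"
      by (rule subgroup.subgroup_is_group[OF U Z.is_group])
    have "?\<beta> [^]\<^bsub>cocycle_group H\<^esub> n \<in> unitary_cocycles H"
      using U.nat_pow_closed[of ?\<beta> n] b by (simp flip: Z.nat_pow_consistent)
    then have c: "?\<gamma> \<in> unitary_cocycles H"
      using b by (simp add: cocycle_group_power[OF H.is_group] unitary_cocycles_def)
    have z': "cohomologous G \<zeta> (\<lambda>p. \<alpha> p ^ n) (pullback G h ?\<gamma>)"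
      by (rule cohomologous_cong[OF z]) simp_all
    have "\<zeta> g ^ (e * r) = 1" if "g \<in> carrier G" for g
      using rescaling_power[OF a c z' _ that, of e] z1 e that by (simp add: power_mult)
    then have "\<alpha> (x, y) ^ (n * (e * r)) = (?\<beta> (h x, h y) ^ n) ^ (e * r)"
      using cohomologousD(3)[OF cohomologous_power[OF z, of "e * r"] x y] x y
      by (simp add: power_mult[of _ n] del: pullback_apply[of _ H])
    also have "\<dots> = ?\<beta> (h x, h y) ^ (n * e * r)" by (simp only: power_mult[symmetric] mult.assoc)
    also have "\<dots> = 1"
      using r b hom_closed[OF x] hom_closed[OF y]
        H.exponent_unitary_cover_dvd_iff[OF fin_H, of "n * e * r"] by blast
    finally show ?thesis by (simp only: mult.assoc)
  qed
  moreover have "g [^] (n * e * r) = \<one>" if "g \<in> carrier G" for g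
    using power_eq_one[OF that, of e] e that by (simp flip: G.nat_pow_pow)
  ultimately show ?thesis by (simp add: G.exponent_unitary_cover_dvd_iff[OF fin])
qed

end

section \<open>Extension of characters\<close>

text \<open>Let \<open>k\<close> be least positive with \<open>x ^ k\<close> in \<open>K\<close>. A
  value at \<open>x\<close> is compatible with \<open>\<chi>\<close> exactly when its
  \<open>k\<close>-th power is \<open>\<chi> (x ^ k)\<close>, and complex numbers have such
  roots.\<close>

lemma (in comm_group) character_extension_step:
  assumes fin: "finite (carrier G)" and K: "subgroup K G" and x: "x \<in> carrier G"
    and c: "\<chi> \<in> carrier (character_group (G\<lparr>carrier := K\<rparr>))"
  shows "\<exists>L \<psi>. subgroup L G \<and> K \<subseteq> L \<and> x \<in> L \<and>
    \<psi> \<in> carrier (character_group (G\<lparr>carrier := L\<rparr>)) \<and> (\<forall>a\<in>K. \<psi> a = \<chi> a)"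
proof -
  interpret K: subgroup K G by (rule K)
  have cm: "\<chi> (a \<otimes> b) = \<chi> a * \<chi> b" "\<chi> a \<noteq> 0" if "a \<in> K" "b \<in> K" for a b
    using character_group_mult[OF c that] by auto
  have c1: "\<chi> \<one> = 1" by (rule character_group_one[OF c is_group K.one_closed])
  have cpow: "\<chi> (a [^] i) = \<chi> a ^ i \<and> a [^] i \<in> K" if "a \<in> K" for a and i :: nat
    by (induction i) (use that c1 cm in auto)
  have "ord x > 0 \<and> x [^] ord x \<in> K" using ord_ge_1[OF fin x] x by simp
  define k where "k = (LEAST k. k > 0 \<and> x [^] (k :: nat) \<in> K)"
  have k: "k > 0" "x [^] k \<in> K" and kmin: "\<And>i. \<lbrakk>i > 0; x [^] i \<in> K\<rbrakk> \<Longrightarrow> k \<le> i"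
    using LeastI[of "\<lambda>k. k > 0 \<and> x [^] (k :: nat) \<in> K", OF \<open>ord x > 0 \<and> x [^] ord x \<in> K\<close>]
      Least_le[of "\<lambda>k. k > 0 \<and> x [^] (k :: nat) \<in> K"] by (auto simp: k_def)
  have kdvd: "k dvd i" if i: "x [^] i \<in> K" for i
  proof -
    have "x [^] i = (x [^] k) [^] (i div k) \<otimes> x [^] (i mod k)"
      using x by (simp add: nat_pow_pow nat_pow_mult)
    then have "x [^] (i mod k) = inv ((x [^] k) [^] (i div k)) \<otimes> x [^] i"
      using x by (simp add: inv_solve_left)
    then have "x [^] (i mod k) \<in> K" using i cpow[OF k(2)] by simp
    then show ?thesis using kmin[of "i mod k"] mod_less_divisor[OF k(1), of i]
      by (auto simp: dvd_eq_mod_eq_0)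
  qed
  obtain z where z: "z ^ k = \<chi> (x [^] k)" using ex_complex_root[OF k(1)] by blast
  have z0: "z \<noteq> 0" using z k cm(2)[OF k(2) k(2)] by (auto simp: power_0_left)
  \<comment> \<open>The value must not depend on the representation \<open>a * x ^ i\<close>. The
    difference \<open>d\<close> of two exponents is a multiple of \<open>k\<close>, which gives
    \<open>\<chi> (x ^ d) = z ^ d\<close>.\<close>
  have well_aux: "\<chi> a * z ^ i = \<chi> b * z ^ j"
    if "a \<in> K" "b \<in> K" and e: "a \<otimes> x [^] i = b \<otimes> x [^] j" and "i \<le> j" for a b and i j :: nat
  proof -
    obtain d where j: "j = d + i" using \<open>i \<le> j\<close> by (metis add.commute le_Suc_ex)
    have "a \<otimes> x [^] i = (b \<otimes> x [^] d) \<otimes> x [^] i"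
      using e that(2) x by (simp add: j m_assoc nat_pow_mult)
    then have ab: "a = b \<otimes> x [^] d" using that x by simp
    then have "x [^] d = inv b \<otimes> a" using that(2) x by (simp flip: m_assoc)
    then have d: "x [^] d \<in> K" using that by simp
    then obtain q where q: "d = k * q" using kdvd by blast
    have "\<chi> (x [^] d) = z ^ d"
      using cpow[OF k(2), of q] x by (simp add: q power_mult z nat_pow_pow)
    then show ?thesis using cm(1)[OF that(2) d] by (simp add: ab j power_add)
  qed
  have well: "\<chi> a * z ^ i = \<chi> b * z ^ j"
    if "a \<in> K" "b \<in> K" "a \<otimes> x [^] i = b \<otimes> x [^] j" for a b and i j :: nat
    using well_aux[of a b i j] well_aux[of b a j i] that by (cases "i \<le> j") auto
  \<comment> \<open>Natural exponents suffice as \<open>x\<close> has finite order; inverses are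
    reached through \<open>x ^ (ord x - 1)\<close>.\<close>
  define L where "L = {a \<otimes> x [^] i | a i. a \<in> K \<and> (i :: nat) \<in> UNIV}"
  have LI: "a \<otimes> x [^] i \<in> L" if "a \<in> K" for a and i :: nat using that by (auto simp: L_def)
  have LE: "\<exists>a i. a \<in> K \<and> y = a \<otimes> x [^] (i :: nat)" if "y \<in> L" for y using that by (auto simp: L_def)
  define \<psi> where "\<psi> = (\<lambda>y\<in>L. SOME w. \<exists>a i. a \<in> K \<and> y = a \<otimes> x [^] (i :: nat) \<and> w = \<chi> a * z ^ i)"
  have psi: "\<psi> (a \<otimes> x [^] i) = \<chi> a * z ^ i" if "a \<in> K" for a and i :: nat
  proof -
    have "(SOME w. \<exists>b j. b \<in> K \<and> a \<otimes> x [^] i = b \<otimes> x [^] (j :: nat) \<and> w = \<chi> b * z ^ j) = \<chi> a * z ^ i"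
    proof (rule some_equality)
      show "\<exists>b j. b \<in> K \<and> a \<otimes> x [^] i = b \<otimes> x [^] (j :: nat) \<and> \<chi> a * z ^ i = \<chi> b * z ^ j"
        using that by blast
      fix w assume "\<exists>b j. b \<in> K \<and> a \<otimes> x [^] i = b \<otimes> x [^] (j :: nat) \<and> w = \<chi> b * z ^ j"
      then show "w = \<chi> a * z ^ i" using well[OF _ that] by metis
    qed
    then show ?thesis using LI[OF that, of i] by (simp add: \<psi>_def)
  qed
  have mult: "(a \<otimes> x [^] i) \<otimes> (b \<otimes> x [^] j) = (a \<otimes> b) \<otimes> x [^] (i + j)"
    if "a \<in> K" "b \<in> K" for a b and i j :: nat
  proof -
    have "a \<in> carrier G" "b \<in> carrier G" "x [^] i \<in> carrier G" "x [^] j \<in> carrier G"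
      using that x by simp_all
    then have "(a \<otimes> x [^] i) \<otimes> (b \<otimes> x [^] j) = (a \<otimes> b) \<otimes> (x [^] i \<otimes> x [^] j)"
      by (simp only: m_ac m_closed)
    then show ?thesis by (simp only: nat_pow_mult[OF x])
  qed
  have L: "subgroup L G"
  proof (rule subgroupI)
    show "L \<subseteq> carrier G" using x K.subset by (auto simp: L_def)
    show "L \<noteq> {}" using LI[OF K.one_closed] by blast
  next
    fix y assume "y \<in> L"
    then obtain a and i :: nat where a: "a \<in> K" and y: "y = a \<otimes> x [^] i" using LE by blast
    have "i * (ord x - 1) + i = ord x * i"
      using ord_ge_1[OF fin x] by (cases "ord x") (auto simp: algebra_simps)
    then have "(inv a \<otimes> x [^] (i * (ord x - 1))) \<otimes> y = \<one>"
      using a x mult[of "inv a" a "i * (ord x - 1)" i] by (simp add: y flip: nat_pow_pow)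
    then have "inv y = inv a \<otimes> x [^] (i * (ord x - 1))"
      using a x by (intro inv_equality) (simp_all add: y)
    then show "inv y \<in> L" using a LI by simp
  next
    fix y y' assume "y \<in> L" "y' \<in> L"
    then obtain a b and i j :: nat
      where "a \<in> K" "y = a \<otimes> x [^] i" "b \<in> K" "y' = b \<otimes> x [^] j" using LE by metis
    then show "y \<otimes> y' \<in> L" using LI[of "a \<otimes> b"] by (simp add: mult)
  qed
  moreover have "a \<in> L \<and> \<psi> a = \<chi> a" if "a \<in> K" for a
    using LI[OF that, of 0] psi[OF that, of 0] that by simp
  moreover have "x \<in> L" using LI[OF K.one_closed, of 1] x by simp
  moreover have "\<psi> \<in> carrier (character_group (G\<lparr>carrier := L\<rparr>))"
    unfolding character_group_iff
  proof (intro conjI ballI; simp)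
    show "\<psi> \<in> extensional L" by (simp add: \<psi>_def)
    fix y assume "y \<in> L"
    then obtain a and i :: nat where a: "a \<in> K" "y = a \<otimes> x [^] i" using LE by metis
    then show "\<psi> y \<noteq> 0" using psi z0 cm(2) by simp
    fix y' assume "y' \<in> L"
    then obtain b and j :: nat where b: "b \<in> K" "y' = b \<otimes> x [^] j" using LE by metis
    show "\<psi> (y \<otimes> y') = \<psi> y * \<psi> y'"
      using a b psi cm(1) by (simp add: mult power_add)
  qed
  ultimately show ?thesis by (intro exI[of _ L] exI[of _ \<psi>]) auto
qed

text \<open>\<open>character_extension_step\<close> enlarges the domain by any given element, so a
  maximal subgroup carrying an extension is the whole group.\<close>

lemma (in comm_group) ex_character_extension:
  assumes fin: "finite (carrier G)" and B: "subgroup B G"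
    and c: "\<chi> \<in> carrier (character_group (G\<lparr>carrier := B\<rparr>))"
  shows "\<exists>\<psi>\<in>carrier (character_group G). \<forall>a\<in>B. \<psi> a = \<chi> a"
proof -
  define S where "S = {K. subgroup K G \<and> B \<subseteq> K \<and>
    (\<exists>\<psi>\<in>carrier (character_group (G\<lparr>carrier := K\<rparr>)). \<forall>a\<in>B. \<psi> a = \<chi> a)}"
  have "S \<subseteq> Pow (carrier G)" using subgroup.subset by (auto simp: S_def)
  then have "finite S" using fin finite_subset by blast
  moreover have "B \<in> S" using B c by (auto simp: S_def)
  ultimately obtain K where K: "K \<in> S" and max: "\<And>L. \<lbrakk>L \<in> S; K \<subseteq> L\<rbrakk> \<Longrightarrow> K = L"
    using finite_has_maximal2 by metis
  obtain \<psi> where psi: "\<psi> \<in> carrier (character_group (G\<lparr>carrier := K\<rparr>))" "\<forall>a\<in>B. \<psi> a = \<chi> a"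
    and sub: "subgroup K G" "B \<subseteq> K" using K by (auto simp: S_def)
  have "x \<in> K" if x: "x \<in> carrier G" for x
  proof -
    obtain L \<xi> where L: "subgroup L G" "K \<subseteq> L" "x \<in> L"
      "\<xi> \<in> carrier (character_group (G\<lparr>carrier := L\<rparr>))" "\<forall>a\<in>K. \<xi> a = \<psi> a"
      using character_extension_step[OF fin sub(1) x psi(1)] by blast
    have "\<forall>a\<in>B. \<xi> a = \<chi> a" using L(5) psi(2) sub(2) by (simp add: subset_iff)
    then have "L \<in> S" using L sub(2) unfolding S_def by blast
    then show ?thesis using max[of L] L by blast
  qed
  then have "K = carrier G" using subgroup.subset[OF sub(1)] by blast
  moreover have "carrier (character_group (G\<lparr>carrier := carrier G\<rparr>)) = carrier (character_group G)"
    by (auto simp: character_group_iff)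
  ultimately show ?thesis using psi by blast
qed

section \<open>Surjection between unitary covers\<close>

lemma (in group_hom) pullback_hom:
  assumes "finite (carrier G)" "finite (carrier H)"
  shows "pullback G h \<in> hom (cocycle_group H\<lparr>carrier := unitary_cocycles H\<rparr>)
    (cocycle_group G\<lparr>carrier := unitary_cocycles G\<rparr>)"
  using pullback_unitary[OF assms]
  by (auto simp: hom_def cocycle_group_mult pullback_def fun_eq_iff restrict_def)

text \<open>Inflation embeds the unitary cocycles of \<open>H\<close> into those of
  \<open>G\<close>. The dual map on characters is surjective because characters extend from
  subgroups of a finite abelian group.\<close>

lemma (in group_hom) ex_epi_unitary_cover:
  assumes fin: "finite (carrier G)" and surj: "h ` carrier G = carrier H"
  shows "\<exists>f. f \<in> epi (unitary_cover G) (unitary_cover H)"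
proof -
  have fin_H: "finite (carrier H)" using fin surj by (metis finite_imageI)
  have lift: "\<exists>x\<in>carrier G. h x = q" if "q \<in> carrier H" for q
  proof -
    have "q \<in> h ` carrier G" using that surj by simp
    then show ?thesis by (rule imageE) (rule bexI, simp_all)
  qed
  interpret GU: cocycle_subgroup G "unitary_cocycles G" by (rule G.cocycle_subgroup_unitary[OF fin])
  interpret HU: cocycle_subgroup H "unitary_cocycles H" by (rule H.cocycle_subgroup_unitary[OF fin_H])
  let ?UG = "cocycle_group G\<lparr>carrier := unitary_cocycles G\<rparr>"
    and ?UH = "cocycle_group H\<lparr>carrier := unitary_cocycles H\<rparr>"
  interpret UG: comm_group ?UG
    by (rule group.group_comm_groupI[OF GU.H.subgroup_is_group[OF GU.Z.is_group]])
      (simp add: GU.H_cocycle GU.Z.m_comm)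
  have UH: "group ?UH" by (rule HU.H.subgroup_is_group) (rule HU.Z.is_group)
  interpret pb: group_hom ?UH ?UG "pullback G h"
    by (intro group_hom.intro group_hom_axioms.intro UH UG.is_group pullback_hom fin fin_H)
  have inj: "inj_on (pullback G h) (unitary_cocycles H)"
  proof (rule inj_onI)
    fix \<alpha> \<beta> assume a: "\<alpha> \<in> unitary_cocycles H" and b: "\<beta> \<in> unitary_cocycles H"
      and e: "pullback G h \<alpha> = pullback G h \<beta>"
    show "\<alpha> = \<beta>"
    proof (rule extensionalityI)
      show "\<alpha> \<in> extensional (carrier H \<times> carrier H)" "\<beta> \<in> extensional (carrier H \<times> carrier H)"
        using a b by (simp_all add: HU.H_cocycle cocycle_groupD(1))
      fix p assume "p \<in> carrier H \<times> carrier H"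
      then obtain q r where p: "p = (q, r)" and q: "q \<in> carrier H" and r: "r \<in> carrier H"
        by (rule SigmaE)
      obtain x y where x: "x \<in> carrier G" "h x = q" and y: "y \<in> carrier G" "h y = r"
        using lift[OF q] lift[OF r] by blast
      have "pullback G h \<alpha> (x, y) = pullback G h \<beta> (x, y)" by (simp only: e)
      then show "\<alpha> p = \<beta> p" unfolding p pullback_apply[OF x(1) y(1)] x(2) y(2) .
    qed
  qed
  \<comment> \<open>The map is \<open>h\<close> on the group and the dual of inflation on
    characters. It respects the cocycle factor because an inflated cocycle at \<open>(g, g')\<close>
    has the value at \<open>(h g, h g')\<close>.\<close>
  define f where "f = (\<lambda>(g, \<chi>). (h g, \<lambda>\<alpha>\<in>unitary_cocycles H. \<chi> (pullback G h \<alpha> :: _ \<Rightarrow> complex) :: complex))"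
  have f_dual: "(\<lambda>\<alpha>\<in>unitary_cocycles H. \<chi> (pullback G h \<alpha>)) \<in> carrier HU.dual"
    if c: "\<chi> \<in> carrier GU.dual" for \<chi>
    using c pb.hom_closed pb.hom_mult HU.H.m_closed
    by (simp add: HU.dual_iff GU.dual_iff)
  have "f \<in> hom GU.E HU.E"
  proof (rule homI)
    fix e assume "e \<in> carrier GU.E"
    then show "f e \<in> carrier HU.E"
      using f_dual by (auto simp: f_def carrier_cocycle_extension)
  next
    fix e e' assume "e \<in> carrier GU.E" "e' \<in> carrier GU.E"
    then show "f (e \<otimes>\<^bsub>GU.E\<^esub> e') = f e \<otimes>\<^bsub>HU.E\<^esub> f e'"
      using pb.hom_closed
      by (auto simp: f_def carrier_cocycle_extension mult_cocycle_extension fun_eq_iff restrict_def)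
  qed
  moreover have "f ` carrier GU.E = carrier HU.E"
  proof
    show "f ` carrier GU.E \<subseteq> carrier HU.E"
      using \<open>f \<in> hom GU.E HU.E\<close> by (auto simp: hom_def)
    show "carrier HU.E \<subseteq> f ` carrier GU.E"
    proof
      fix e assume "e \<in> carrier HU.E"
      then obtain q \<psi> where e: "e = (q, \<psi>)" and q: "q \<in> carrier H" and psi: "\<psi> \<in> carrier HU.dual"
        by (auto simp: carrier_cocycle_extension)
      obtain g where g: "g \<in> carrier G" "h g = q" using lift[OF q] by blast
      let ?B = "pullback G h ` unitary_cocycles H"
      \<comment> \<open>Injectivity transports \<open>\<psi>\<close> to a character of the image of
        inflation; an extension of it to all unitary cocycles of \<open>G\<close> gives the
        preimage.\<close>
      define \<chi> where "\<chi> = (\<lambda>\<beta>\<in>?B. \<psi> (inv_into (unitary_cocycles H) (pullback G h) \<beta>))"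
      have chi: "\<chi> (pullback G h \<alpha>) = \<psi> \<alpha>" if "\<alpha> \<in> unitary_cocycles H" for \<alpha>
        using that inj by (simp add: \<chi>_def)
      have B: "subgroup ?B ?UG" using pb.subgroup_img_is_subgroup[OF pb.G.subgroup_self] by simp
      have "\<chi> \<in> carrier (character_group (?UG\<lparr>carrier := ?B\<rparr>))"
        unfolding character_group_iff
      proof (intro conjI ballI; simp)
        show "\<chi> \<in> extensional ?B" by (simp add: \<chi>_def)
        fix b assume "b \<in> ?B"
        then obtain \<alpha> where a: "\<alpha> \<in> unitary_cocycles H" "b = pullback G h \<alpha>" by blast
        then show "\<chi> b \<noteq> 0" using chi psi HU.dual_iff by simp
        fix b' assume "b' \<in> ?B"
        then obtain \<alpha>' where a': "\<alpha>' \<in> unitary_cocycles H" "b' = pullback G h \<alpha>'" by blast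
        have "b \<otimes>\<^bsub>cocycle_group G\<^esub> b' = pullback G h (\<alpha> \<otimes>\<^bsub>cocycle_group H\<^esub> \<alpha>')"
          using pb.hom_mult a a' by simp
        then show "\<chi> (b \<otimes>\<^bsub>cocycle_group G\<^esub> b') = \<chi> b * \<chi> b'"
          using a a' chi HU.H.m_closed[OF a(1) a'(1)] psi HU.dual_iff by simp
      qed
      then obtain \<xi> where xi: "\<xi> \<in> carrier GU.dual" "\<forall>b\<in>?B. \<xi> b = \<chi> b"
        using UG.ex_character_extension[OF _ B] G.finite_unitary_cocycles[OF fin] by auto
      have "\<psi> = (\<lambda>\<alpha>\<in>unitary_cocycles H. \<xi> (pullback G h \<alpha>))"
        using psi xi(2) chi by (intro extensionalityI[of _ "unitary_cocycles H"])
          (simp_all add: HU.dual_iff)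
      then have "f (g, \<xi>) = e" using g by (simp add: f_def e)
      moreover have "(g, \<xi>) \<in> carrier GU.E" using g xi by (simp add: carrier_cocycle_extension)
      ultimately show "e \<in> f ` carrier GU.E" by blast
    qed
  qed
  ultimately show ?thesis by (auto simp: epi_def unitary_cover_def)
qed

section \<open>Quotients and semidirect products\<close>

lemma (in normal) kernel_r_coset:
  "kernel G (G Mod H) (\<lambda>g. H #> g) = H"
proof -
  have "H #> g = H \<longleftrightarrow> g \<in> H" if "g \<in> carrier G" for g
    using that coset_join1[OF _ that subgroup_axioms] coset_join2[OF that subgroup_axioms] by blast
  then show ?thesis using subset by (auto simp: kernel_def)
qed

lemma (in normal) ex_finite_epi:
  assumes fin: "finite (carrier G)"
  shows "\<exists>s. finite_epi G (G Mod H) (\<lambda>g. H #> g) s (exponent (unitary_cover (G\<lparr>carrier := H\<rparr>)))"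
proof -
  \<comment> \<open>The last clause picks the identity as representative of the trivial coset, as
    \<open>section_one\<close> demands.\<close>
  have "\<exists>g\<in>carrier G. H #> g = p \<and> (p = H \<longrightarrow> g = \<one>)" if "p \<in> carrier (G Mod H)" for p
  proof (cases "p = H")
    case True
    then show ?thesis
      using coset_join2[OF _ subgroup_axioms subgroup.one_closed[OF subgroup_axioms]] by auto
  next
    case False
    then show ?thesis using that by (auto simp: carrier_FactGroup)
  qed
  then obtain s where s: "\<And>p. p \<in> carrier (G Mod H) \<Longrightarrow>
      s p \<in> carrier G \<and> H #> s p = p \<and> (p = H \<longrightarrow> s p = \<one>)"
    by metis
  have "H \<in> carrier (G Mod H)"
    using group.is_monoid[OF factorgroup_is_group] monoid.one_closed by fastforce
  then have "finite_epi G (G Mod H) (\<lambda>g. H #> g) s (exponent (unitary_cover (G\<lparr>carrier := H\<rparr>)))"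
    using s fin
    by (intro finite_epi.intro finite_epi_axioms.intro group_hom.intro group_hom_axioms.intro
        is_group factorgroup_is_group r_coset_hom_Mod) (simp_all add: kernel_r_coset)
  then show ?thesis by blast
qed

text \<open>The projection onto \<open>H\<close> along \<open>N\<close> is a homomorphism with
  kernel \<open>N\<close>, split by the inclusion of \<open>H\<close>.\<close>

lemma (in group) ex_finite_split_epi:
  assumes fin: "finite (carrier G)" and semi: "is_semidirect_product G N H"
    and n: "exponent (unitary_cover (G\<lparr>carrier := N\<rparr>)) dvd n"
  shows "\<exists>h. finite_split_epi G (G\<lparr>carrier := H\<rparr>) h (\<lambda>x. x) n"
proof -
  have NG: "N \<lhd> G" and HG: "subgroup H G" and NH: "N <#> H = carrier G" and int: "N \<inter> H = {\<one>}"
    using semi by (simp_all add: is_semidirect_product_def)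
  interpret N: normal N G by (rule NG)
  interpret H: subgroup H G by (rule HG)
  have decomp: "\<exists>a\<in>N. \<exists>k\<in>H. g = a \<otimes> k" if "g \<in> carrier G" for g
    using that unfolding NH[symmetric] by (auto simp: set_mult_def)
  have unique: "k = l" if "a \<in> N" "b \<in> N" "k \<in> H" "l \<in> H" "a \<otimes> k = b \<otimes> l" for a b k l
  proof -
    have mem: "a \<in> carrier G" "b \<in> carrier G" "k \<in> carrier G" "l \<in> carrier G"
      using that by simp_all
    have "inv b \<otimes> a = l \<otimes> inv k"
      using that(5) mem by (metis inv_closed inv_solve_left inv_solve_right m_assoc m_closed)
    then have "l \<otimes> inv k \<in> N \<inter> H" using that by (metis IntI N.m_closed N.m_inv_closed H.m_closed H.m_inv_closed)
    then have "l \<otimes> inv k = \<one>" using int by simp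
    then show ?thesis using mem by (metis inv_closed inv_inv inv_equality)
  qed
  define h where "h g = (THE k. k \<in> H \<and> (\<exists>a\<in>N. g = a \<otimes> k))" for g
  have h: "h (a \<otimes> k) = k" if "a \<in> N" "k \<in> H" for a k
    unfolding h_def by (rule the_equality) (use that unique in blast)+
  have h_H: "h k = k" if "k \<in> H" for k using h[OF N.one_closed that] that by simp
  have hom: "h \<in> hom G (G\<lparr>carrier := H\<rparr>)"
  proof (rule homI)
    fix g assume "g \<in> carrier G"
    then obtain a k where "a \<in> N" "k \<in> H" "g = a \<otimes> k" using decomp by blast
    then show "h g \<in> carrier (G\<lparr>carrier := H\<rparr>)" by (simp add: h)
  next
    fix g g' assume "g \<in> carrier G" "g' \<in> carrier G"
    then obtain a k b l where g: "a \<in> N" "k \<in> H" "g = a \<otimes> k" and g': "b \<in> N" "l \<in> H" "g' = b \<otimes> l"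
      using decomp by metis
    have mem: "a \<in> carrier G" "b \<in> carrier G" "k \<in> carrier G" "l \<in> carrier G"
      using g g' by simp_all
    have "inv k \<otimes> (k \<otimes> l) = l" using mem by (simp flip: m_assoc)
    then have "g \<otimes> g' = (a \<otimes> (k \<otimes> b \<otimes> inv k)) \<otimes> (k \<otimes> l)"
      using mem by (simp add: g(3) g'(3) m_assoc)
    moreover have "k \<otimes> b \<otimes> inv k \<in> N" by (rule N.inv_op_closed2[OF mem(3) g'(1)])
    ultimately show "h (g \<otimes> g') = h g \<otimes>\<^bsub>G\<lparr>carrier := H\<rparr>\<^esub> h g'"
      using g g' by (simp add: h)
  qed
  have "kernel G (G\<lparr>carrier := H\<rparr>) h = N"
  proof
    show "kernel G (G\<lparr>carrier := H\<rparr>) h \<subseteq> N"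
    proof
      fix g assume "g \<in> kernel G (G\<lparr>carrier := H\<rparr>) h"
      then have g: "g \<in> carrier G" "h g = \<one>" by (simp_all add: kernel_def)
      then obtain a k where "a \<in> N" "k \<in> H" "g = a \<otimes> k" using decomp by blast
      then show "g \<in> N" using g(2) by (simp add: h)
    qed
    show "N \<subseteq> kernel G (G\<lparr>carrier := H\<rparr>) h"
      using h[OF _ H.one_closed] N.subset by (force simp: kernel_def)
  qed
  then have "finite_split_epi G (G\<lparr>carrier := H\<rparr>) h (\<lambda>x. x) n"
    using fin n hom h_H
    by (intro finite_split_epi.intro finite_split_epi_axioms.intro finite_epi.intro
        finite_epi_axioms.intro group_hom.intro group_hom_axioms.intro is_group
        H.subgroup_is_group) simp_all
  then show ?thesis by blast
qed

theorem theorem2: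
  fixes G :: "('a, 'b) monoid_scheme"
  assumes "group G" and "finite (carrier G)"
  shows
    "central_extension (unitary_cover G) fst G \<and>
     projective_lifting_property (unitary_cover G) fst G \<and>
     (\<forall>(\<Gamma> :: ('c, 'd) monoid_scheme) (\<pi> :: 'c \<Rightarrow> 'a).
        central_extension \<Gamma> \<pi> G \<and> projective_lifting_property \<Gamma> \<pi> G
          \<longrightarrow> exponent (unitary_cover G) \<le> exponent \<Gamma>) \<and>
     (\<forall>N. N \<lhd> G \<longrightarrow>
        exponent (schur_multiplier G)
          dvd exponent (unitary_cover (G\<lparr>carrier := N\<rparr>)) * exponent (schur_multiplier (G Mod N)) \<and>
        exponent (unitary_cover G)
          dvd exponent (unitary_cover (G\<lparr>carrier := N\<rparr>)) * exponent (unitary_cover (G Mod N)) \<and>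
        (\<exists>f. f \<in> epi (unitary_cover G) (unitary_cover (G Mod N))) \<and>
        (\<forall>H. is_semidirect_product G N H \<longrightarrow>
           exponent (schur_multiplier G)
             dvd lcm (exponent (unitary_cover (G\<lparr>carrier := N\<rparr>)))
                     (exponent (schur_multiplier (G\<lparr>carrier := H\<rparr>))) \<and>
           exponent (unitary_cover G)
             dvd lcm (exponent (unitary_cover (G\<lparr>carrier := N\<rparr>)) * exponent (G\<lparr>carrier := H\<rparr>))
                     (exponent (unitary_cover (G\<lparr>carrier := H\<rparr>)))))"
proof -
  interpret G: group G by fact
  note fin = assms(2)
  have 1: "exponent (unitary_cover G) \<le> exponent \<Gamma>"
    if ext: "central_extension \<Gamma> \<pi> G" and plp: "projective_lifting_property \<Gamma> \<pi> G"
    for \<Gamma> :: "('c, 'd) monoid_scheme" and \<pi> :: "'c \<Rightarrow> 'a"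
  proof -
    \<comment> \<open>Finiteness makes the exponent positive, which turns divisibility into the
      inequality.\<close>
    have "group \<Gamma>" "finite (carrier \<Gamma>)" using ext by (simp_all add: central_extension_def)
    then have "exponent \<Gamma> > 0" by (rule group.exponent_pos)
    with G.exponent_unitary_cover_dvd_exponent[OF fin ext plp] show ?thesis by (rule dvd_imp_le)
  qed
  {
    fix N assume "N \<lhd> G"
    then interpret N: normal N G .
    obtain s where
      "finite_epi G (G Mod N) (\<lambda>g. N #>\<^bsub>G\<^esub> g) s (exponent (unitary_cover (G\<lparr>carrier := N\<rparr>)))"
      using N.ex_finite_epi[OF fin] by blast
    then interpret Q: finite_epi G "G Mod N" "\<lambda>g. N #>\<^bsub>G\<^esub> g" s
      "exponent (unitary_cover (G\<lparr>carrier := N\<rparr>))" .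
    note Q.exponent_schur_multiplier_dvd[OF dvd_refl] Q.exponent_unitary_cover_dvd[OF dvd_refl]
      Q.ex_epi_unitary_cover[OF fin carrier_FactGroup[symmetric]]
  }
  note 2 = this
  {
    fix N H assume semi: "is_semidirect_product G N H"
    let ?eN = "exponent (unitary_cover (G\<lparr>carrier := N\<rparr>))" and ?eH = "exponent (G\<lparr>carrier := H\<rparr>)"
      and ?m = "exponent (schur_multiplier (G\<lparr>carrier := H\<rparr>))"
      and ?u = "exponent (unitary_cover (G\<lparr>carrier := H\<rparr>))"
    \<comment> \<open>For the multiplier the bound is applied with the lcm as \<open>n\<close>; for
      the cover, \<open>n\<close> is the exponent of the cover of \<open>N\<close> itself.\<close>
    obtain h where "finite_split_epi G (G\<lparr>carrier := H\<rparr>) h (\<lambda>x. x) (lcm ?eN ?m)"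
      using G.ex_finite_split_epi[OF fin semi dvd_lcm1] by blast
    then have a: "exponent (schur_multiplier G) dvd lcm ?eN ?m"
      by (rule finite_split_epi.exponent_schur_multiplier_dvd_split) simp
    obtain h where "finite_split_epi G (G\<lparr>carrier := H\<rparr>) h (\<lambda>x. x) ?eN"
      using G.ex_finite_split_epi[OF fin semi dvd_refl] by blast
    then interpret S: finite_split_epi G "G\<lparr>carrier := H\<rparr>" h "\<lambda>x. x" ?eN .
    have e: "q [^]\<^bsub>G\<lparr>carrier := H\<rparr>\<^esub> ?eH = \<one>\<^bsub>G\<lparr>carrier := H\<rparr>\<^esub>"
      if "q \<in> carrier (G\<lparr>carrier := H\<rparr>)" for q
      using S.H.exponent_dvd_iff[of ?eH] that by simp
    \<comment> \<open>This writes the lcm in the form \<open>n * e * r\<close> of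
      \<open>exponent_unitary_cover_dvd_split\<close>.\<close>
    obtain r where r: "lcm (?eN * ?eH) ?u = ?eN * ?eH * r"
      using dvd_lcm1[of "?eN * ?eH" ?u] by (rule dvdE)
    have "?u dvd ?eN * ?eH * r" unfolding r[symmetric] by (rule dvd_lcm2)
    from S.exponent_unitary_cover_dvd_split[OF e this]
    have "exponent (unitary_cover G) dvd lcm (?eN * ?eH) ?u" unfolding r .
    note a this
  }
  note 3 = this
  show ?thesis
    using G.central_extension_unitary_cover[OF fin] G.projective_lifting_property_unitary_cover[OF fin]
      1 2 3
    by (intro conjI allI impI) blast+
qed

end
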